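(* Suppose that $\mathfrak{P}_+$ is nonempty, that $\int_K \frac{1}{Q}\,dx=\infty$ for all $q\in\partial\mathfrak{P}_+$, and that $c\in\mathfrak{C}_+$. Then the map $g^c:\mathfrak{P}_+\to\mathfrak{P}_+$, sending $p$ to the unique minimizer of $\mathbb{J}^c_p$ over $\bar{\mathfrak{P}}_+$ (and restricted to $p\in\mathfrak{P}_+$), is a diffeomorphism onto its image $\mathfrak{Q}_+:=g^c(\mathfrak{P}_+)$.
   Context: $K\subset\mathbb{R}^d$ is a compact set with $d$-dimensional (nonempty) interior whose closure is precisely $K$; $dx$ is Lebesgue measure. $\alpha_1,\dots,\alpha_n$ are real-valued, continuous, linearly independent functions on $K$. For $p,q\in\mathbb{R}^n$ write $P(x)=\sum_{k=1}^n p_k\alpha_k(x)$, $Q(x)=\sum_{k=1}^n q_k\alpha_k(x)$. $\mathfrak{P}_+$ is the set of $p\in\mathbb{R}^n$ such that $P(x)>0$ for all $x\in K$; $\bar{\mathfrak{P}}_+$ is its closure and $\partial\mathfrak{P}_+=\bar{\mathfrak{P}}_+\setminus\mathfrak{P}_+$. Standing assumption: for every $p\in\bar{\mathfrak{P}}_+\setminus\{0\}$ the zero set of $P$ in $K$ has Lebesgue measure zero. With $\langle c,p\rangle=\sum_{k=1}^n c_kp_k$, let $\mathfrak{C}_+=\{c\in\mathbb{R}^n\mid \langle c,p\rangle>0 \text{ for all } p\in\bar{\mathfrak{P}}_+\setminus\{0\}\}$. For $c\in\mathfrak{C}_+$ and $p\in\bar{\mathfrak{P}}_+\setminus\{0\}$,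 the functional $\mathbb{J}^c_p:\bar{\mathfrak{P}}_+\to\mathbb{R}\cup\{\infty\}$ is $\mathbb{J}^c_p(q)=\langle c,q\rangle-\int_K P\log Q\,dx$ (with $-\log 0=+\infty$). It has a unique minimizer over $\bar{\mathfrak{P}}_+$, and under the hypotheses of the claim this minimizer lies in $\mathfrak{P}_+$ whenever $p\in\mathfrak{P}_+$, so $g^c$ is well defined. Where $Q(x)=0$, $1/Q(x)$ is read as $+\infty$. *)

theory Defs
  imports "HOL-Analysis.Analysis"
begin

definition gen_poly :: "('n::finite \<Rightarrow> real^'d \<Rightarrow> real) \<Rightarrow> real^'n \<Rightarrow> real^'d \<Rightarrow> real" where
  "gen_poly \<alpha> p x = (\<Sum>k\<in>UNIV. p $ k * \<alpha> k x)"

text \<open>Linear independence of the family of restrictions to \<open>K\<close>.\<close>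

definition lin_indep_on :: "(real^'d) set \<Rightarrow> ('n::finite \<Rightarrow> real^'d \<Rightarrow> real) \<Rightarrow> bool" where
  "lin_indep_on K \<alpha> \<longleftrightarrow> (\<forall>p. (\<forall>x\<in>K. gen_poly \<alpha> p x = 0) \<longrightarrow> p = 0)"

definition pos_cone :: "(real^'d) set \<Rightarrow> ('n::finite \<Rightarrow> real^'d \<Rightarrow> real) \<Rightarrow> (real^'n) set" where
  "pos_cone K \<alpha> = {p. \<forall>x\<in>K. gen_poly \<alpha> p x > 0}"

definition dual_cone :: "(real^'d) set \<Rightarrow> ('n::finite \<Rightarrow> real^'d \<Rightarrow> real) \<Rightarrow> (real^'n) set" where
  "dual_cone K \<alpha> = {c. \<forall>p \<in> closure (pos_cone K \<alpha>) - {0}. c \<bullet> p > 0}"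

text \<open>The logarithm on the nonnegative reals with \<open>log 0 = -\<infinity>\<close>; recall that \<open>ln 0 = 0\<close> in HOL.\<close>

definition elog :: "real \<Rightarrow> ereal" where
  "elog y = (if y = 0 then -\<infinity> else ereal (ln y))"

text \<open>The Lebesgue integral of an extended-real function as the integral of its positive part
  minus that of its negative part (\<open>e2ennreal\<close> sends negative arguments to \<open>0\<close>).  It is
  meaningful when the two are not both infinite.\<close>

definition ext_integral :: "'a measure \<Rightarrow> ('a \<Rightarrow> ereal) \<Rightarrow> ereal" where
  "ext_integral M f =
     enn2ereal (\<integral>\<^sup>+ x. e2ennreal (f x) \<partial>M) - enn2ereal (\<integral>\<^sup>+ x. e2ennreal (- f x) \<partial>M)"

text \<open>For \<open>p\<close> and \<open>q\<close> in the closed cone, \<open>P log Q\<close> is bounded above on the compact set \<open>K\<close>,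
  so its integral lies in \<open>[-\<infinity>, \<infinity>)\<close> and the functional takes values in \<open>(-\<infinity>, \<infinity>]\<close>.
  The convention \<open>0 * (-\<infinity>) = 0\<close> of \<open>ereal\<close> matters only on the zero set of \<open>P\<close>.\<close>

definition Jfun :: "(real^'d) set \<Rightarrow> ('n::finite \<Rightarrow> real^'d \<Rightarrow> real) \<Rightarrow>
    real^'n \<Rightarrow> real^'n \<Rightarrow> real^'n \<Rightarrow> ereal" where
  "Jfun K \<alpha> c p q =
     ereal (c \<bullet> q)
     - ext_integral (lebesgue_on K) (\<lambda>x. ereal (gen_poly \<alpha> p x) * elog (gen_poly \<alpha> q x))"

definition is_minimizer :: "(real^'d) set \<Rightarrow> ('n::finite \<Rightarrow> real^'d \<Rightarrow> real) \<Rightarrow>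
    real^'n \<Rightarrow> real^'n \<Rightarrow> real^'n \<Rightarrow> bool" where
  "is_minimizer K \<alpha> c p q \<longleftrightarrow>
     is_arg_min (Jfun K \<alpha> c p) (\<lambda>q. q \<in> closure (pos_cone K \<alpha>)) q"

definition gmap :: "(real^'d) set \<Rightarrow> ('n::finite \<Rightarrow> real^'d \<Rightarrow> real) \<Rightarrow>
    real^'n \<Rightarrow> real^'n \<Rightarrow> real^'n" where
  "gmap K \<alpha> c p = (THE q. is_minimizer K \<alpha> c p q)"

text \<open>\<open>C\<^sup>k\<close> maps on an open subset of a finite-dimensional space: the map and its iterated
  derivatives in fixed directions up to order \<open>k\<close> exist (as Frechet derivatives) and are
  continuous.\<close>

primrec Ck_on :: "nat \<Rightarrow> 'a::euclidean_space set \<Rightarrow> ('a \<Rightarrow> 'b::euclidean_space) \<Rightarrow> bool" where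
  "Ck_on 0 S f \<longleftrightarrow> continuous_on S f"
| "Ck_on (Suc k) S f \<longleftrightarrow>
     (\<forall>x\<in>S. f differentiable (at x)) \<and>
     (\<forall>v. Ck_on k S (\<lambda>x. frechet_derivative f (at x) v))"

definition smooth_on :: "'a::euclidean_space set \<Rightarrow> ('a \<Rightarrow> 'b::euclidean_space) \<Rightarrow> bool" where
  "smooth_on S f \<longleftrightarrow> (\<forall>k. Ck_on k S f)"

definition diffeomorphism :: "'a::euclidean_space set \<Rightarrow> 'b::euclidean_space set \<Rightarrow>
    ('a \<Rightarrow> 'b) \<Rightarrow> bool" where
  "diffeomorphism S T f \<longleftrightarrow>
     open S \<and> open T \<and> bij_betw f S T \<and> smooth_on S f \<and> smooth_on T (inv_into S f)"

end

theory Submission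
  imports Defs
begin

text \<open>
  A point \<open>q\<close> of the open cone is stationary for \<open>p\<close> when \<open>c\<^sub>k = \<integral> \<alpha>\<^sub>k P / Q\<close> for all \<open>k\<close>.  By concavity
  of the logarithm a stationary point is the unique minimizer over the closed cone, and the divergence of
  \<open>\<integral> 1 / Q\<close> on the boundary forces a minimizer into the open cone, where it is stationary.
  The stationarity equation reads \<open>M(q) p = c\<close> with the Gram matrix \<open>M(q) = (\<integral> \<alpha>\<^sub>i \<alpha>\<^sub>j / Q)\<close>, which is
  invertible; hence \<open>g\<close> has the inverse \<open>h(q) = M(q)\<^sup>-\<^sup>1 c\<close>, and its image is the open set of those
  \<open>q\<close> with \<open>h(q)\<close> in the open cone.  Differentiating \<open>M(q) h(q) = c\<close> gives \<open>M(q) Dh(q) = N\<close> with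
  \<open>N = (\<integral> \<alpha>\<^sub>i \<alpha>\<^sub>j P / Q\<^sup>2)\<close> invertible, so \<open>Dg(p) = N\<^sup>-\<^sup>1 M(g(p))\<close>.  By Cramer's rule the entries of
  both derivatives are rational expressions in moments \<open>\<integral> A / Q\<^sup>m\<close> and coordinates, a class closed
  under differentiation, so \<open>g\<close> and \<open>h\<close> are smooth.
\<close>

section \<open>Real functions generated by algebraic operations\<close>

text \<open>The rule \<open>cong\<close> makes membership depend only on the values on
  \<open>S\<close>, so identities and divisions that are valid just on \<open>S\<close> may be
  used.\<close>

inductive alg_closure :: "'a set \<Rightarrow> ('a \<Rightarrow> real) set \<Rightarrow> ('a \<Rightarrow> real) \<Rightarrow> bool"
  for S :: "'a set" and B :: "('a \<Rightarrow> real) set" where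
  gen: "f \<in> B \<Longrightarrow> alg_closure S B f"
| const: "alg_closure S B (\<lambda>x. r)"
| add: "alg_closure S B f \<Longrightarrow> alg_closure S B g \<Longrightarrow> alg_closure S B (\<lambda>x. f x + g x)"
| mult: "alg_closure S B f \<Longrightarrow> alg_closure S B g \<Longrightarrow> alg_closure S B (\<lambda>x. f x * g x)"
| inverse: "alg_closure S B f \<Longrightarrow> (\<And>x. x \<in> S \<Longrightarrow> f x \<noteq> 0) \<Longrightarrow> alg_closure S B (\<lambda>x. inverse (f x))"
| cong: "alg_closure S B f \<Longrightarrow> (\<And>x. x \<in> S \<Longrightarrow> g x = f x) \<Longrightarrow> alg_closure S B g"

lemma alg_closure_sum:
  assumes "\<And>i. i \<in> A \<Longrightarrow> alg_closure S B (f i)"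
  shows "alg_closure S B (\<lambda>x. \<Sum>i\<in>A. f i x)"
  using assms
  by (induction A rule: infinite_finite_induct) (auto intro: alg_closure.intros)

lemma alg_closure_prod:
  assumes "\<And>i. i \<in> A \<Longrightarrow> alg_closure S B (f i)"
  shows "alg_closure S B (\<lambda>x. \<Prod>i\<in>A. f i x)"
  using assms
  by (induction A rule: infinite_finite_induct) (auto intro: alg_closure.intros)

lemma alg_closure_det:
  fixes M :: "'a \<Rightarrow> real^'n^'n"
  assumes "\<And>i j. alg_closure S B (\<lambda>x. M x $ i $ j)"
  shows "alg_closure S B (\<lambda>x. det (M x))"
  unfolding det_def
  by (intro alg_closure_sum alg_closure.mult alg_closure.const alg_closure_prod assms)

text \<open>Each coordinate of the solution is a quotient of determinants, which are polynomials in
  the entries; no regularity of \<open>u\<close> has to be known beforehand.\<close>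

lemma alg_closure_cramer:
  fixes M :: "'a \<Rightarrow> real^'n^'n" and u b :: "'a \<Rightarrow> real^'n"
  assumes M: "\<And>i j. alg_closure S B (\<lambda>x. M x $ i $ j)"
    and b: "\<And>i. alg_closure S B (\<lambda>x. b x $ i)"
    and nz: "\<And>x. x \<in> S \<Longrightarrow> det (M x) \<noteq> 0"
    and eq: "\<And>x. x \<in> S \<Longrightarrow> M x *v u x = b x"
  shows "alg_closure S B (\<lambda>x. u x $ k)"
proof (rule alg_closure.cong)
  have "alg_closure S B (\<lambda>x. (\<chi> i j. if j = k then b x $ i else M x $ i $ j) $ i $ j)" for i j
    using M[of i j] b[of i] by (cases "j = k") simp_all
  then show "alg_closure S B
      (\<lambda>x. det (\<chi> i j. if j = k then b x $ i else M x $ i $ j) * inverse (det (M x)))"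
    by (intro alg_closure.mult alg_closure.inverse alg_closure_det M nz)
next
  fix x assume "x \<in> S"
  then show "u x $ k = det (\<chi> i j. if j = k then b x $ i else M x $ i $ j) * inverse (det (M x))"
    using eq nz by (simp add: cramer field_simps)
qed

section \<open>Stability of the class under directional derivatives\<close>

definition alg_differentiable ::
    "'a::euclidean_space set \<Rightarrow> ('a \<Rightarrow> real) set \<Rightarrow> ('a \<Rightarrow> real) \<Rightarrow> bool" where
  "alg_differentiable S B f \<longleftrightarrow>
     (\<exists>D. (\<forall>x\<in>S. (f has_derivative D x) (at x)) \<and> (\<forall>v. alg_closure S B (\<lambda>x. D x v)))"

lemma alg_differentiableI:
  assumes "\<And>x. x \<in> S \<Longrightarrow> (f has_derivative D x) (at x)"
    and "\<And>v. alg_closure S B (\<lambda>x. D x v)"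
  shows "alg_differentiable S B f"
  using assms unfolding alg_differentiable_def by blast

text \<open>Induction on the generation: the sum, product and reciprocal rules express a derivative
  algebraically through members of the class and their derivatives, so only the generators have to
  be checked.\<close>

lemma alg_closure_differentiable:
  fixes S :: "'a::euclidean_space set"
  assumes "open S" and B: "\<And>b. b \<in> B \<Longrightarrow> alg_differentiable S B b"
    and "alg_closure S B f"
  shows "alg_differentiable S B f"
  using assms(3)
proof induction
  case (gen f)
  then show ?case by (rule B)
next
  case (const r)
  show ?case
    by (rule alg_differentiableI[where D = "\<lambda>_ _. 0"]) (auto intro: alg_closure.const)
next
  case (add f g)
  then obtain D E where D: "\<And>x. x \<in> S \<Longrightarrow> (f has_derivative D x) (at x)"
      "\<And>v. alg_closure S B (\<lambda>x. D x v)"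
    and E: "\<And>x. x \<in> S \<Longrightarrow> (g has_derivative E x) (at x)" "\<And>v. alg_closure S B (\<lambda>x. E x v)"
    unfolding alg_differentiable_def by blast
  show ?case
    by (rule alg_differentiableI[where D = "\<lambda>x v. D x v + E x v"])
       (auto intro!: has_derivative_add D E alg_closure.add)
next
  case (mult f g)
  then obtain D E where D: "\<And>x. x \<in> S \<Longrightarrow> (f has_derivative D x) (at x)"
      "\<And>v. alg_closure S B (\<lambda>x. D x v)"
    and E: "\<And>x. x \<in> S \<Longrightarrow> (g has_derivative E x) (at x)" "\<And>v. alg_closure S B (\<lambda>x. E x v)"
    unfolding alg_differentiable_def by blast
  show ?case
    by (rule alg_differentiableI[where D = "\<lambda>x v. f x * E x v + D x v * g x"])
       (auto intro!: has_derivative_mult D E alg_closure.add alg_closure.mult mult)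
next
  case (inverse f)
  then obtain D where D: "\<And>x. x \<in> S \<Longrightarrow> (f has_derivative D x) (at x)"
      "\<And>v. alg_closure S B (\<lambda>x. D x v)"
    unfolding alg_differentiable_def by blast
  have "alg_closure S B (\<lambda>x. (- 1) * (inverse (f x) * D x v * inverse (f x)))" for v
    by (intro alg_closure.mult alg_closure.const alg_closure.inverse inverse D)
  then show ?case
    by (intro alg_differentiableI[where D = "\<lambda>x v. - (inverse (f x) * D x v * inverse (f x))"]
        Deriv.has_derivative_inverse D inverse) simp_all
next
  case (cong f g)
  then obtain D where D: "\<And>x. x \<in> S \<Longrightarrow> (f has_derivative D x) (at x)"
      "\<And>v. alg_closure S B (\<lambda>x. D x v)"
    unfolding alg_differentiable_def by blast
  show ?case
  proof (rule alg_differentiableI)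
    fix x assume "x \<in> S"
    then show "(g has_derivative D x) (at x)"
      using has_derivative_transform_within_open[OF D(1) \<open>open S\<close>] cong(2) by metis
  qed (rule D)
qed

text \<open>As the class is stable under directional derivatives, \<open>C\<^sup>k\<close> for all \<open>k\<close> follows by induction,
  without a chain rule for higher derivatives.\<close>

lemma alg_closure_vec_smooth:
  fixes S :: "'a::euclidean_space set" and f :: "'a \<Rightarrow> real^'n"
  assumes "open S" and B: "\<And>b. b \<in> B \<Longrightarrow> alg_differentiable S B b"
    and "\<And>i. alg_closure S B (\<lambda>x. f x $ i)"
  shows "smooth_on S f"
proof -
  have *: "\<exists>D. (\<forall>x\<in>S. (f has_derivative D x) (at x)) \<and> (\<forall>v i. alg_closure S B (\<lambda>x. D x v $ i))"
    if f: "\<And>i. alg_closure S B (\<lambda>x. f x $ i)" for f :: "'a \<Rightarrow> real^'n"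
  proof -
    have "\<exists>D. (\<forall>x\<in>S. ((\<lambda>x. f x $ i) has_derivative D x) (at x)) \<and> (\<forall>v. alg_closure S B (\<lambda>x. D x v))"
      for i using alg_closure_differentiable[OF \<open>open S\<close> B f] unfolding alg_differentiable_def .
    then obtain D where D: "\<And>i x. x \<in> S \<Longrightarrow> ((\<lambda>x. f x $ i) has_derivative D i x) (at x)"
      "\<And>i v. alg_closure S B (\<lambda>x. D i x v)"
      by metis
    have "(f has_derivative (\<lambda>v. \<chi> i. D i x v)) (at x)" if "x \<in> S" for x
      unfolding has_derivative_componentwise_within[of f]
      using D(1)[OF that] by (auto simp: Basis_vec_def inner_axis)
    then show ?thesis
      using D(2) by (intro exI[of _ "\<lambda>x v. \<chi> i. D i x v"]) simp
  qed
  have "Ck_on k S f" if "\<And>i. alg_closure S B (\<lambda>x. f x $ i)" for k and f :: "'a \<Rightarrow> real^'n"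
    using that
  proof (induction k arbitrary: f)
    case 0
    then obtain D where "\<forall>x\<in>S. (f has_derivative D x) (at x)" using * by blast
    then show ?case
      by (auto intro!: continuous_at_imp_continuous_on has_derivative_continuous)
  next
    case (Suc k)
    then obtain D where D: "\<forall>x\<in>S. (f has_derivative D x) (at x)"
      and alg: "\<And>v i. alg_closure S B (\<lambda>x. D x v $ i)"
      using *[of f] by blast
    \<comment> \<open>\<open>Ck_on\<close> refers to \<open>frechet_derivative\<close>, which is
      identified with \<open>D\<close> on \<open>S\<close> only; the rule \<open>cong\<close>
      bridges the gap.\<close>
    have "frechet_derivative f (at x) = D x" if "x \<in> S" for x
      using D that frechet_derivative_at by metis
    then have "alg_closure S B (\<lambda>x. frechet_derivative f (at x) v $ i)" for v i
      by (intro alg_closure.cong[OF alg]) simp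
    then show ?case
      using Suc.IH D by (auto simp: differentiable_def)
  qed
  then show ?thesis
    unfolding smooth_on_def using assms(3) by blast
qed

section \<open>Integrals of continuous functions over a compact set\<close>

lemma integrable_continuous_on_compact:
  fixes f :: "'a::euclidean_space \<Rightarrow> real"
  assumes "compact K" "continuous_on K f"
  shows "integrable (lebesgue_on K) f"
proof -
  have K: "K \<in> lmeasurable" using assms lmeasurable_compact by blast
  interpret finite_measure "lebesgue_on K"
    by (rule finite_measure_lebesgue_on[OF K])
  have "bounded (f ` K)"
    using assms compact_continuous_image compact_imp_bounded by blast
  then obtain C where C: "\<And>x. x \<in> K \<Longrightarrow> norm (f x) \<le> C"
    unfolding bounded_iff by blast
  show ?thesis
    using K C assms
    by (intro integrable_const_bound[where B = C] continuous_imp_measurable_on_sets_lebesgue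
        AE_I2) (auto simp: fmeasurableD)
qed

lemma integral_abs_le_measure:
  fixes f :: "'a::euclidean_space \<Rightarrow> real"
  assumes "compact K" "continuous_on K f" and le: "\<And>x. x \<in> K \<Longrightarrow> \<bar>f x\<bar> \<le> e"
  shows "\<bar>integral\<^sup>L (lebesgue_on K) f\<bar> \<le> e * measure lebesgue K"
proof -
  have K: "K \<in> lmeasurable" using assms lmeasurable_compact by blast
  interpret finite_measure "lebesgue_on K"
    by (rule finite_measure_lebesgue_on[OF K])
  have "\<bar>integral\<^sup>L (lebesgue_on K) f\<bar> \<le> (\<integral>x. \<bar>f x\<bar> \<partial>lebesgue_on K)"
    by (rule integral_abs_bound)
  also have "\<dots> \<le> (\<integral>x. e \<partial>lebesgue_on K)"
    using le by (intro integral_mono integrable_abs integrable_continuous_on_compact assms) auto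
  also have "\<dots> = e * measure lebesgue K"
    using K by (simp add: measure_restrict_space fmeasurableD)
  finally show ?thesis .
qed

text \<open>Compactness of \<open>K\<close> makes the convergence of \<open>F q\<close> to
  \<open>F q0\<close> uniform on \<open>K\<close>, and a uniform error \<open>d\<close> changes the
  integral by at most \<open>d\<close> times the measure of \<open>K\<close>.\<close>

lemma continuous_on_parametric_integral:
  fixes F :: "'b::topological_space \<Rightarrow> 'a::euclidean_space \<Rightarrow> real"
  assumes "compact K" and cont: "continuous_on (U \<times> K) (\<lambda>z. F (fst z) (snd z))"
  shows "continuous_on U (\<lambda>q. \<integral>x. F q x \<partial>lebesgue_on K)"
  unfolding continuous_on_def
proof (rule ballI, rule tendstoI)
  fix q0 and e :: real assume q0: "q0 \<in> U" and "e > 0"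
  have m: "measure lebesgue K \<ge> 0" by simp
  define d where "d = e / (measure lebesgue K + 1)"
  have "d > 0" using \<open>e > 0\<close> m by (simp add: d_def add_nonneg_pos)
  have d: "d * measure lebesgue K < e"
    using \<open>e > 0\<close> m by (simp add: d_def divide_simps add_nonneg_pos)
  have cont1: "continuous_on K (F q)" if "q \<in> U" for q
    using continuous_on_compose2[OF cont continuous_on_Pair[OF continuous_on_const continuous_on_id], of q] that
    by auto
  obtain X where X: "q0 \<in> X" "open X"
    and bd: "\<forall>q\<in>X \<inter> U. \<forall>x\<in>K. dist (F (fst (q, x)) (snd (q, x))) (F (fst (q0, x)) (snd (q0, x))) \<le> d"
    using continuous_on_prod_compactE[OF cont \<open>compact K\<close> q0 \<open>d > 0\<close>] .
  have "\<forall>\<^sub>F q in at q0 within U. q \<in> X \<inter> U"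
    using X eventually_at_topological by auto
  then show "\<forall>\<^sub>F q in at q0 within U.
      dist (\<integral>x. F q x \<partial>lebesgue_on K) (\<integral>x. F q0 x \<partial>lebesgue_on K) < e"
  proof eventually_elim
    case (elim q)
    have "(\<integral>x. F q x \<partial>lebesgue_on K) - (\<integral>x. F q0 x \<partial>lebesgue_on K)
        = (\<integral>x. F q x - F q0 x \<partial>lebesgue_on K)"
      using elim q0 cont1
      by (intro Bochner_Integration.integral_diff[symmetric] integrable_continuous_on_compact assms(1)) auto
    also have "\<bar>\<dots>\<bar> \<le> d * measure lebesgue K"
      using elim q0 cont1 bd
      by (intro integral_abs_le_measure assms(1) continuous_intros) (auto simp: dist_real_def)
    finally show ?case using d by (simp add: dist_real_def)
  qed
qed

text \<open>First-order Taylor remainder of \<open>1 / y ^ m\<close> at \<open>z\<close>, with a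
  constant uniform in \<open>y, z \<ge> \<delta>\<close> as differentiation under the integral
  requires. The crude factor \<open>m\<^sup>2\<close> survives the induction because
  \<open>m\<^sup>2 + m + 1 \<le> (m + 1)\<^sup>2\<close>.\<close>

lemma inverse_power_remainder:
  fixes y z \<delta> :: real
  assumes "\<delta> > 0" "y \<ge> \<delta>" "z \<ge> \<delta>"
  shows "\<bar>1 / y ^ m - 1 / z ^ m + m * (y - z) / z ^ (m + 1)\<bar>
           \<le> (real m)\<^sup>2 * (1 / \<delta>) ^ (m + 2) * (y - z)\<^sup>2"
proof (induction m)
  case 0
  show ?case by simp
next
  case (Suc m)
  have pos: "y > 0" "z > 0" using assms by auto
  define b where "b = 1 / \<delta>"
  define u where "u = 1 / y"
  define w where "w = 1 / z"
  define h where "h = y - z"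
  have uw: "0 \<le> u" "u \<le> b" "0 \<le> w" "w \<le> b" "0 \<le> b"
    using assms by (auto simp: u_def w_def b_def frac_le)
  have diff: "u - w = - (u * w * h)"
    using pos by (simp add: u_def w_def h_def field_simps)
  define E where "E = u ^ m - w ^ m + m * h * w ^ (m + 1)"
  have E: "\<bar>E\<bar> \<le> (real m)\<^sup>2 * b ^ (m + 2) * h\<^sup>2"
    using Suc by (simp add: E_def u_def w_def h_def b_def power_one_over)
  \<comment> \<open>Multiplying the remainder \<open>E\<close> by \<open>u\<close> and correcting
    with \<open>u - w = - (u * w * h)\<close> leaves two terms that are already quadratic in
    \<open>h\<close>.\<close>
  have "u ^ Suc m - w ^ Suc m + real (Suc m) * h * w ^ (Suc m + 1)
      = u * E + m * (u * w ^ (m + 2)) * h\<^sup>2 + (u * w ^ (m + 2)) * h\<^sup>2"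
  proof -
    have "u * U - w * W + (r + 1) * h * (w * w * W)
        = u * (U - W + r * h * (w * W)) + r * (u * (w * w * W)) * h * h + u * (w * w * W) * h * h"
      for U W r :: real using diff by algebra
    from this[of "u ^ m" "w ^ m" "real m"] show ?thesis
      by (simp add: E_def power2_eq_square mult.assoc add.commute)
  qed
  also have "\<bar>\<dots>\<bar> \<le> b * ((real m)\<^sup>2 * b ^ (m + 2) * h\<^sup>2) + m * (b * b ^ (m + 2)) * h\<^sup>2
      + (b * b ^ (m + 2)) * h\<^sup>2"
    (is "_ \<le> ?R")
  proof -
    have uw_le: "u * w ^ (m + 2) \<le> b * b ^ (m + 2)"
      using uw by (intro mult_mono power_mono) auto
    have nonneg: "0 \<le> u * w ^ (m + 2)" using uw by simp
    have "\<bar>u * E\<bar> \<le> b * ((real m)\<^sup>2 * b ^ (m + 2) * h\<^sup>2)"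
      using uw E by (simp add: abs_mult mult_mono)
    moreover have "\<bar>m * (u * w ^ (m + 2)) * h\<^sup>2\<bar> \<le> m * (b * b ^ (m + 2)) * h\<^sup>2"
      using uw_le nonneg by (simp add: abs_mult mult_mono mult_left_mono mult_right_mono)
    moreover have "\<bar>(u * w ^ (m + 2)) * h\<^sup>2\<bar> \<le> (b * b ^ (m + 2)) * h\<^sup>2"
      using uw_le nonneg by (simp only: abs_mult abs_of_nonneg abs_power2 mult_right_mono zero_le_power2)
    ultimately show ?thesis by linarith
  qed
  also have "\<dots> = ((real m)\<^sup>2 + m + 1) * b ^ (Suc m + 2) * h\<^sup>2"
    by (simp add: algebra_simps)
  also have "\<dots> \<le> (real (Suc m))\<^sup>2 * b ^ (Suc m + 2) * h\<^sup>2"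
    using uw by (intro mult_right_mono) (auto simp: power2_eq_square algebra_simps)
  finally show ?case
    by (simp add: u_def w_def h_def b_def power_one_over)
qed

section \<open>Generalized polynomials and their moments\<close>

lemma gen_poly_inner: "gen_poly \<alpha> p x = p \<bullet> (\<chi> k. \<alpha> k x)"
  by (simp add: gen_poly_def inner_vec_def)

lemma gen_poly_add: "gen_poly \<alpha> (p + q) x = gen_poly \<alpha> p x + gen_poly \<alpha> q x"
  by (simp add: gen_poly_inner inner_add_left)

lemma gen_poly_scaleR: "gen_poly \<alpha> (r *\<^sub>R p) x = r * gen_poly \<alpha> p x"
  by (simp add: gen_poly_inner)

lemma gen_poly_minus: "gen_poly \<alpha> (- p) x = - gen_poly \<alpha> p x"
  by (simp add: gen_poly_inner)

lemma gen_poly_diff: "gen_poly \<alpha> (p - q) x = gen_poly \<alpha> p x - gen_poly \<alpha> q x"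
  by (simp add: gen_poly_inner inner_diff_left)

lemma gen_poly_0: "gen_poly \<alpha> 0 x = 0"
  by (simp add: gen_poly_inner)

lemmas gen_poly_linear = gen_poly_add gen_poly_scaleR gen_poly_minus gen_poly_diff gen_poly_0

text \<open>The zero set is closed and contains almost every point of the open interior, hence all
  of it; density of the interior in \<open>K\<close> does the rest.\<close>

lemma continuous_AE_0_imp_0:
  fixes f :: "'a::euclidean_space \<Rightarrow> real"
  assumes "compact K" and K: "closure (interior K) = K" and f: "continuous_on K f"
    and zero: "AE x in lebesgue_on K. f x = 0"
    and "x \<in> K"
  shows "f x = 0"
proof (rule continuous_constant_on_closure[of "interior K"])
  show "continuous_on (closure (interior K)) f" "x \<in> closure (interior K)"
    using assms by simp_all
next
  fix x assume x: "x \<in> interior K"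
  let ?C = "{x \<in> K. f x = 0}"
  have "K \<in> sets lebesgue" using \<open>compact K\<close> lmeasurable_compact by blast
  then have "AE x in lebesgue. x \<in> K \<longrightarrow> f x = 0"
    using zero by (simp add: AE_restrict_space_iff)
  then have "AE x\<in>interior K in lebesgue. x \<in> ?C"
    by eventually_elim (use interior_subset in auto)
  moreover have "closed ?C"
    using f \<open>compact K\<close> continuous_closed_preimage_constant compact_imp_closed by blast
  ultimately show "f x = 0"
    using mem_closed_if_AE_lebesgue_open[OF open_interior _ _ x] by blast
qed

locale moment_problem =
  fixes K :: "(real^'d::finite) set" and \<alpha> :: "'n::finite \<Rightarrow> real^'d \<Rightarrow> real"
  assumes compact_K: "compact K" and interior_nonempty: "interior K \<noteq> {}"
    and closure_interior: "closure (interior K) = K"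
    and continuous_alpha: "\<And>k. continuous_on K (\<alpha> k)"
    and indep: "lin_indep_on K \<alpha>"
begin

lemma K_nonempty: "K \<noteq> {}"
  using interior_nonempty interior_subset by blast

lemma continuous_basis: "continuous_on K (\<lambda>x. \<chi> k. \<alpha> k x)"
  by (intro continuous_on_vec_lambda continuous_alpha)

lemma continuous_gen_poly: "continuous_on K (gen_poly \<alpha> p)"
  unfolding gen_poly_inner by (intro continuous_intros continuous_basis)

lemma continuous_gen_poly_pair: "continuous_on (U \<times> K) (\<lambda>z. gen_poly \<alpha> (fst z) (snd z))"
  unfolding gen_poly_inner
  by (intro continuous_on_inner continuous_on_fst continuous_on_id
      continuous_on_compose2[OF continuous_basis] continuous_on_snd) auto

lemma gen_poly_bound: "\<exists>L>0. \<forall>q. \<forall>x\<in>K. \<bar>gen_poly \<alpha> q x\<bar> \<le> L * norm q"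
proof -
  have "bounded ((\<lambda>x. \<chi> k. \<alpha> k x) ` K)"
    using compact_continuous_image[OF continuous_basis compact_K] compact_imp_bounded by blast
  then obtain L where L: "L > 0" "\<And>x. x \<in> K \<Longrightarrow> norm (\<chi> k. \<alpha> k x) \<le> L"
    unfolding bounded_pos by auto
  have "\<bar>gen_poly \<alpha> q x\<bar> \<le> L * norm q" if "x \<in> K" for q x
  proof -
    have "\<bar>gen_poly \<alpha> q x\<bar> \<le> norm q * norm (\<chi> k. \<alpha> k x)"
      unfolding gen_poly_inner by (rule Cauchy_Schwarz_ineq2)
    also have "\<dots> \<le> norm q * L"
      using L(2)[OF that] by (simp add: mult_left_mono)
    finally show ?thesis by (simp add: mult.commute)
  qed
  then show ?thesis using L(1) by blast
qed

section \<open>The open cone of coefficient vectors of positive functions\<close>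

lemma pos_coneD: "q \<in> pos_cone K \<alpha> \<Longrightarrow> x \<in> K \<Longrightarrow> gen_poly \<alpha> q x > 0"
  by (simp add: pos_cone_def)

lemma zero_notin_pos_cone: "0 \<notin> pos_cone K \<alpha>"
  using K_nonempty by (auto simp: pos_cone_def gen_poly_0)

lemma pos_cone_lower_bound:
  assumes "q \<in> pos_cone K \<alpha>"
  obtains \<delta> where "\<delta> > 0" "\<And>x. x \<in> K \<Longrightarrow> gen_poly \<alpha> q x \<ge> \<delta>"
  using continuous_attains_inf[OF compact_K K_nonempty continuous_gen_poly[of q]]
    pos_coneD[OF assms] by metis

text \<open>\<open>gen_poly \<alpha> q\<close> has a positive minimum on \<open>K\<close>, and a
  small \<open>v\<close> changes it by at most \<open>L * norm v\<close>; one lower bound thus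
  serves all of \<open>K\<close> and a whole ball around \<open>q\<close>.\<close>

lemma pos_cone_nhds:
  assumes "q \<in> pos_cone K \<alpha>"
  obtains \<delta> e where "\<delta> > 0" "e > 0"
    "\<And>v x. x \<in> K \<Longrightarrow> norm v < e \<Longrightarrow> gen_poly \<alpha> (q + v) x \<ge> \<delta>"
proof -
  obtain \<delta> where \<delta>: "\<delta> > 0" "\<And>x. x \<in> K \<Longrightarrow> gen_poly \<alpha> q x \<ge> \<delta>"
    using pos_cone_lower_bound[OF assms] by blast
  obtain L where L: "L > 0" "\<And>q x. x \<in> K \<Longrightarrow> \<bar>gen_poly \<alpha> q x\<bar> \<le> L * norm q"
    using gen_poly_bound by blast
  have "gen_poly \<alpha> (q + v) x \<ge> \<delta> / 2" if "x \<in> K" "norm v < \<delta> / (2 * L)" for v x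
  proof -
    have "L * norm v \<le> \<delta> / 2" using that L(1) by (simp add: field_simps)
    then show ?thesis
      using \<delta>(2)[OF that(1)] L(2)[OF that(1), of v] by (simp add: gen_poly_add)
  qed
  then show ?thesis using that[of "\<delta> / 2" "\<delta> / (2 * L)"] \<delta>(1) L(1) by simp
qed

lemma open_pos_cone: "open (pos_cone K \<alpha>)"
  unfolding open_dist
proof
  fix q assume "q \<in> pos_cone K \<alpha>"
  then obtain \<delta> e where e: "\<delta> > 0" "e > 0"
    "\<And>v x. x \<in> K \<Longrightarrow> norm v < e \<Longrightarrow> gen_poly \<alpha> (q + v) x \<ge> \<delta>"
    using pos_cone_nhds by blast
  have "y \<in> pos_cone K \<alpha>" if "dist y q < e" for y
    unfolding pos_cone_def
    using e(1) e(3)[of _ "y - q"] that by (fastforce simp: dist_norm)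
  then show "\<exists>e>0. \<forall>y. dist y q < e \<longrightarrow> y \<in> pos_cone K \<alpha>"
    using e(2) by blast
qed

text \<open>Keeping the weight and the exponent free makes the family closed under differentiation
  in \<open>q\<close>: up to a factor, \<open>A\<close> becomes
  \<open>A * gen_poly \<alpha> v\<close> and \<open>m\<close> becomes \<open>m + 1\<close>.\<close>

definition mom :: "(real^'d \<Rightarrow> real) \<Rightarrow> nat \<Rightarrow> real^'n \<Rightarrow> real" where
  "mom A m q = (\<integral>x. A x / gen_poly \<alpha> q x ^ m \<partial>lebesgue_on K)"

lemma continuous_mom_integrand:
  assumes "continuous_on K A" "q \<in> pos_cone K \<alpha>"
  shows "continuous_on K (\<lambda>x. A x / gen_poly \<alpha> q x ^ m)"
  using pos_coneD[OF assms(2)]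
  by (intro continuous_intros assms continuous_gen_poly) force

lemma integrable_mom_integrand:
  assumes "continuous_on K A" "q \<in> pos_cone K \<alpha>"
  shows "integrable (lebesgue_on K) (\<lambda>x. A x / gen_poly \<alpha> q x ^ m)"
  by (intro integrable_continuous_on_compact compact_K continuous_mom_integrand assms)

lemma mom_sum:
  assumes "\<And>i. i \<in> I \<Longrightarrow> continuous_on K (A i)" "q \<in> pos_cone K \<alpha>"
  shows "mom (\<lambda>x. \<Sum>i\<in>I. r i * A i x) m q = (\<Sum>i\<in>I. r i * mom (A i) m q)"
proof -
  have "mom (\<lambda>x. \<Sum>i\<in>I. r i * A i x) m q
      = (\<integral>x. (\<Sum>i\<in>I. r i * (A i x / gen_poly \<alpha> q x ^ m)) \<partial>lebesgue_on K)"
    unfolding mom_def by (simp add: sum_divide_distrib)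
  also have "\<dots> = (\<Sum>i\<in>I. \<integral>x. r i * (A i x / gen_poly \<alpha> q x ^ m) \<partial>lebesgue_on K)"
    by (intro Bochner_Integration.integral_sum integrable_mult_right integrable_mom_integrand assms)
  also have "\<dots> = (\<Sum>i\<in>I. r i * mom (A i) m q)"
    by (simp only: integral_mult_right_zero mom_def)
  finally show ?thesis .
qed

lemma mom_gen_poly:
  assumes "continuous_on K A" "q \<in> pos_cone K \<alpha>"
  shows "mom (\<lambda>x. A x * gen_poly \<alpha> v x) m q = (\<Sum>j\<in>UNIV. v $ j * mom (\<lambda>x. A x * \<alpha> j x) m q)"
  using mom_sum[of UNIV "\<lambda>j x. A x * \<alpha> j x" q "\<lambda>j. v $ j" m] assms continuous_alpha
  by (simp add: gen_poly_def sum_distrib_left mult.left_commute continuous_on_mult)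

text \<open>By \<open>inverse_power_remainder\<close> the linearization error of the integrand is at
  most a constant times \<open>(norm v)\<^sup>2\<close>, uniformly on \<open>K\<close>, so it can be
  integrated.\<close>

lemma mom_has_derivative:
  assumes A: "continuous_on K A" and q: "q \<in> pos_cone K \<alpha>"
  shows "(mom A m has_derivative (\<lambda>v. - real m * mom (\<lambda>x. A x * gen_poly \<alpha> v x) (m + 1) q)) (at q)"
    (is "(_ has_derivative ?D) _")
  unfolding has_derivative_at
proof
  have "linear (\<lambda>v. \<Sum>j\<in>UNIV. v $ j * mom (\<lambda>x. A x * \<alpha> j x) (m + 1) q)"
    by (intro linearI) (simp_all add: distrib_right sum.distrib sum_distrib_left mult.assoc)
  then have "bounded_linear (\<lambda>v. mom (\<lambda>x. A x * gen_poly \<alpha> v x) (m + 1) q)"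
    unfolding mom_gen_poly[OF A q] by (simp add: linear_conv_bounded_linear)
  then show "bounded_linear ?D"
    by (rule bounded_linear_const_mult)
next
  obtain \<delta> e where e: "\<delta> > 0" "e > 0"
    "\<And>v x. x \<in> K \<Longrightarrow> norm v < e \<Longrightarrow> gen_poly \<alpha> (q + v) x \<ge> \<delta>"
    using pos_cone_nhds[OF q] by blast
  obtain L where L: "L > 0" "\<And>q x. x \<in> K \<Longrightarrow> \<bar>gen_poly \<alpha> q x\<bar> \<le> L * norm q"
    using gen_poly_bound by blast
  have "bounded (A ` K)"
    using compact_continuous_image[OF A compact_K] compact_imp_bounded by blast
  then obtain a where a: "\<And>x. x \<in> K \<Longrightarrow> \<bar>A x\<bar> \<le> a" unfolding bounded_iff by auto
  have "a \<ge> 0" using a K_nonempty by force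
  \<comment> \<open>\<open>a\<close> bounds the weight, \<open>\<delta>\<close> the denominators
    from below, and \<open>L * norm v\<close> the increment of the denominator before taking
    powers.\<close>
  define C where "C = a * ((real m)\<^sup>2 * (1 / \<delta>) ^ (m + 2) * L\<^sup>2) * measure lebesgue K"
  have bound: "norm (mom A m (q + v) - mom A m q - ?D v) \<le> C * (norm v)\<^sup>2" if v: "norm v < e" for v
  proof -
    have qv: "q + v \<in> pos_cone K \<alpha>"
      using e(1) e(3)[OF _ v] unfolding pos_cone_def by fastforce
    let ?f = "\<lambda>x. A x / gen_poly \<alpha> (q + v) x ^ m - A x / gen_poly \<alpha> q x ^ m
        + m * (A x * gen_poly \<alpha> v x / gen_poly \<alpha> q x ^ (m + 1))"
    have cont: "continuous_on K (\<lambda>x. A x * gen_poly \<alpha> v x)"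
      by (intro continuous_intros A continuous_gen_poly)
    have "mom A m (q + v) - mom A m q - ?D v = (\<integral>x. ?f x \<partial>lebesgue_on K)"
      unfolding mom_def
      using integrable_mom_integrand[OF A qv, of m] integrable_mom_integrand[OF A q, of m]
        integrable_mom_integrand[OF cont q, of "m + 1"]
      by (simp del: times_divide_eq_right)
    moreover have "\<bar>\<integral>x. ?f x \<partial>lebesgue_on K\<bar>
        \<le> (a * ((real m)\<^sup>2 * (1 / \<delta>) ^ (m + 2) * L\<^sup>2) * (norm v)\<^sup>2) * measure lebesgue K"
    proof (rule integral_abs_le_measure[OF compact_K])
      show "continuous_on K ?f"
        by (intro continuous_on_add continuous_on_diff continuous_on_mult continuous_on_const
            continuous_mom_integrand A cont q qv)
    next
      fix x assume x: "x \<in> K"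
      let ?y = "gen_poly \<alpha> (q + v) x" and ?z = "gen_poly \<alpha> q x"
      have ge: "?y \<ge> \<delta>" "?z \<ge> \<delta>"
        using e(3)[OF x v] e(3)[OF x, of 0] e(2) by simp_all
      have yz: "?y - ?z = gen_poly \<alpha> v x" by (simp add: gen_poly_add)
      have "?f x = A x * (1 / ?y ^ m - 1 / ?z ^ m + m * (?y - ?z) / ?z ^ (m + 1))"
        unfolding yz by (simp add: algebra_simps)
      then have "\<bar>?f x\<bar> = \<bar>A x\<bar> * \<bar>1 / ?y ^ m - 1 / ?z ^ m + m * (?y - ?z) / ?z ^ (m + 1)\<bar>"
        by (simp only: abs_mult)
      also have "\<dots> \<le> a * ((real m)\<^sup>2 * (1 / \<delta>) ^ (m + 2) * (?y - ?z)\<^sup>2)"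
        by (intro mult_mono a x inverse_power_remainder e(1) ge \<open>a \<ge> 0\<close> abs_ge_zero)
      also have "\<dots> \<le> a * ((real m)\<^sup>2 * (1 / \<delta>) ^ (m + 2) * (L * norm v)\<^sup>2)"
        using L(2)[OF x, of v] L(1) e(1) \<open>a \<ge> 0\<close> unfolding yz
        by (intro mult_left_mono) (auto simp: abs_le_square_iff[symmetric] abs_mult)
      finally show "\<bar>?f x\<bar> \<le> a * ((real m)\<^sup>2 * (1 / \<delta>) ^ (m + 2) * L\<^sup>2) * (norm v)\<^sup>2"
        by (simp add: power_mult_distrib mult.assoc)
    qed
    ultimately show ?thesis
      unfolding C_def real_norm_def by (simp only: mult_ac)
  qed
  show "((\<lambda>v. norm (mom A m (q + v) - mom A m q - ?D v) / norm v) \<longlongrightarrow> 0) (at 0)"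
  proof (rule Lim_null_comparison)
    have "\<forall>\<^sub>F v in at 0. norm v < e"
      using e(2) unfolding eventually_at by (auto intro!: exI[of _ e])
    then show "\<forall>\<^sub>F v in at 0. norm (norm (mom A m (q + v) - mom A m q - ?D v) / norm v) \<le> C * norm v"
    proof (eventually_elim)
      case (elim v)
      then show ?case
        using bound[OF elim] by (cases "v = 0") (simp_all add: divide_simps power2_eq_square mult.assoc)
    qed
    show "((\<lambda>v. C * norm v) \<longlongrightarrow> 0) (at (0::real^'n))"
      by (intro tendsto_eq_intros) auto
  qed
qed

end

section \<open>Stationary points are strict minimizers\<close>

lemma ext_integral_AE_real:
  assumes "integrable M r" "AE x in M. f x = ereal (r x)"
  shows "ext_integral M f = ereal (integral\<^sup>L M r)"
proof -
  have "(\<integral>\<^sup>+ x. e2ennreal (f x) \<partial>M) = (\<integral>\<^sup>+ x. ennreal (r x) \<partial>M)"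
    using assms(2) by (intro nn_integral_cong_AE) auto
  moreover have "(\<integral>\<^sup>+ x. e2ennreal (- f x) \<partial>M) = (\<integral>\<^sup>+ x. ennreal (- r x) \<partial>M)"
    using assms(2) by (intro nn_integral_cong_AE) auto
  moreover obtain a b where "0 \<le> a" "0 \<le> b" "(\<integral>\<^sup>+ x. ennreal (r x) \<partial>M) = ennreal a"
    "(\<integral>\<^sup>+ x. ennreal (- r x) \<partial>M) = ennreal b" "integral\<^sup>L M r = a - b"
    using integrableE[OF assms(1)] by metis
  ultimately show ?thesis
    by (simp add: ext_integral_def enn2ereal_ennreal)
qed

lemma ext_integral_minus_infinity:
  assumes "(\<integral>\<^sup>+ x. e2ennreal (f x) \<partial>M) \<noteq> \<infinity>" "(\<integral>\<^sup>+ x. e2ennreal (- f x) \<partial>M) = \<infinity>"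
  shows "ext_integral M f = -\<infinity>"
  using assms
  by (cases "\<integral>\<^sup>+ x. e2ennreal (f x) \<partial>M") (auto simp: ext_integral_def enn2ereal_ennreal top_ereal_def)

lemma measurable_elog [measurable]: "elog \<in> borel_measurable borel"
  unfolding elog_def [abs_def] by measurable

lemma ln_tangent_le:
  fixes y z :: real
  assumes "y > 0" "z > 0"
  shows "ln y \<le> ln z + (y - z) / z"
  using ln_le_minus_one[of "y / z"] assms by (simp add: ln_div diff_divide_distrib)

text \<open>Strict concavity: the tangent meets the graph of the logarithm only at the point of
  contact. Uniqueness of the minimizer rests on this.\<close>

lemma ln_tangent_eq:
  fixes y z :: real
  assumes "y > 0" "z > 0" "ln y = ln z + (y - z) / z"
  shows "y = z"
  using ln_eq_minus_one[of "y / z"] assms by (simp add: ln_div diff_divide_distrib)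

section \<open>The functional and its first-order condition\<close>

context moment_problem
begin

lemma closure_pos_cone_nonneg:
  assumes "q \<in> closure (pos_cone K \<alpha>)" "x \<in> K"
  shows "gen_poly \<alpha> q x \<ge> 0"
proof -
  have "closed {q. 0 \<le> q \<bullet> (\<chi> k. \<alpha> k x)}"
    by (intro closed_Collect_le continuous_intros)
  moreover have "pos_cone K \<alpha> \<subseteq> {q. 0 \<le> q \<bullet> (\<chi> k. \<alpha> k x)}"
    using assms(2) by (auto simp: pos_cone_def gen_poly_inner less_imp_le)
  ultimately show ?thesis
    using assms(1) closure_minimal unfolding gen_poly_inner by blast
qed

lemma gen_poly_AE_0_imp_0:
  assumes "AE x in lebesgue_on K. gen_poly \<alpha> v x = 0"
  shows "v = 0"
  using continuous_AE_0_imp_0[OF compact_K closure_interior continuous_gen_poly assms]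
    indep unfolding lin_indep_on_def by blast

text \<open>For \<open>q\<close> in the open cone, left side minus right side is the derivative of
  \<open>phi c p\<close> at \<open>q\<close> in direction \<open>v\<close>.\<close>

definition stationary :: "real^'n \<Rightarrow> real^'n \<Rightarrow> real^'n \<Rightarrow> bool" where
  "stationary c p q \<longleftrightarrow> (\<forall>v. c \<bullet> v = mom (\<lambda>x. gen_poly \<alpha> p x * gen_poly \<alpha> v x) 1 q)"

text \<open>Real-valued form of the functional, meant for the open cone, where no logarithm of 0
  occurs.\<close>

definition phi :: "real^'n \<Rightarrow> real^'n \<Rightarrow> real^'n \<Rightarrow> real" where
  "phi c p q = c \<bullet> q - (\<integral>x. gen_poly \<alpha> p x * ln (gen_poly \<alpha> q x) \<partial>lebesgue_on K)"

lemma continuous_P_ln: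
  assumes "q \<in> pos_cone K \<alpha>"
  shows "continuous_on K (\<lambda>x. gen_poly \<alpha> p x * ln (gen_poly \<alpha> q x))"
  using pos_coneD[OF assms] by (intro continuous_intros continuous_gen_poly) force

lemma integrable_P_ln:
  assumes "q \<in> pos_cone K \<alpha>"
  shows "integrable (lebesgue_on K) (\<lambda>x. gen_poly \<alpha> p x * ln (gen_poly \<alpha> q x))"
  by (intro integrable_continuous_on_compact compact_K continuous_P_ln assms)

lemma Jfun_eq_phi:
  assumes "q \<in> pos_cone K \<alpha>"
  shows "Jfun K \<alpha> c p q = ereal (phi c p q)"
proof -
  have "ext_integral (lebesgue_on K) (\<lambda>x. ereal (gen_poly \<alpha> p x) * elog (gen_poly \<alpha> q x))
      = ereal (\<integral>x. gen_poly \<alpha> p x * ln (gen_poly \<alpha> q x) \<partial>lebesgue_on K)"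
    using pos_coneD[OF assms]
    by (intro ext_integral_AE_real integrable_P_ln assms AE_I2) (force simp: elog_def)
  then show ?thesis by (simp add: Jfun_def phi_def)
qed

lemma borel_measurable_gen_poly [measurable]:
  "gen_poly \<alpha> p \<in> borel_measurable (lebesgue_on K)"
  using compact_K lmeasurable_compact
  by (intro continuous_imp_measurable_on_sets_lebesgue continuous_gen_poly) blast

text \<open>Integrating \<open>log Q \<le> log Q\<^sub>0 + (Q - Q\<^sub>0) / Q\<^sub>0\<close> against \<open>P\<close> and using stationarity on the
  linear term; if the negative part has infinite integral, the functional is \<open>\<infinity>\<close> at \<open>q\<close>.\<close>

lemma stationary_strict_minimum:
  assumes p: "p \<in> pos_cone K \<alpha>" and q0: "q0 \<in> pos_cone K \<alpha>" and st: "stationary c p q0"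
    and q: "q \<in> closure (pos_cone K \<alpha>)" and ne: "q \<noteq> q0"
  shows "Jfun K \<alpha> c p q0 < Jfun K \<alpha> c p q"
proof -
  define M where "M = lebesgue_on K"
  have [measurable]: "gen_poly \<alpha> q \<in> borel_measurable M" for q
    unfolding M_def by (rule borel_measurable_gen_poly)
  define P where "P = gen_poly \<alpha> p"
  define Q where "Q = gen_poly \<alpha> q"
  define Q0 where "Q0 = gen_poly \<alpha> q0"
  have [measurable]: "P \<in> borel_measurable M" "Q \<in> borel_measurable M" "Q0 \<in> borel_measurable M"
    unfolding P_def Q_def Q0_def by measurable
  have pos: "P x > 0" "Q0 x > 0" "Q x \<ge> 0" if "x \<in> K" for x
    using that pos_coneD p q0 closure_pos_cone_nonneg[OF q] by (auto simp: P_def Q0_def Q_def)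
  define f where "f = (\<lambda>x. ereal (P x) * elog (Q x))"
  define r where "r = (\<lambda>x. P x * ln (Q x))"
  \<comment> \<open>The tangent bound for \<open>r\<close> at \<open>Q0\<close>; it is integrable
    even if \<open>q\<close> lies on the boundary. The exponent 1 matches the integrand of
    \<open>mom\<close>.\<close>
  define u where "u = (\<lambda>x. P x * ln (Q0 x) + P x * gen_poly \<alpha> (q - q0) x / Q0 x ^ 1)"
  have f_meas [measurable]: "f \<in> borel_measurable M" unfolding f_def by measurable
  have r_meas [measurable]: "r \<in> borel_measurable M" unfolding r_def by measurable
  have cont: "continuous_on K (\<lambda>x. P x * gen_poly \<alpha> (q - q0) x)"
    unfolding P_def by (intro continuous_intros continuous_gen_poly)
  have u_int: "integrable M u"
    unfolding u_def M_def Q0_def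
    using integrable_P_ln[OF q0, of p] integrable_mom_integrand[OF cont q0, of 1]
    by (simp add: P_def)
  have u_val: "integral\<^sup>L M u = c \<bullet> q - phi c p q0"
  proof -
    have "integral\<^sup>L M u = (\<integral>x. P x * ln (Q0 x) \<partial>M) + c \<bullet> (q - q0)"
      using st integrable_P_ln[OF q0, of p] integrable_mom_integrand[OF cont q0, of 1]
      unfolding u_def M_def Q0_def stationary_def mom_def P_def by simp
    then show ?thesis by (simp add: phi_def inner_diff_right M_def P_def Q0_def)
  qed
  have u_eq: "u x = P x * (ln (Q0 x) + (Q x - Q0 x) / Q0 x)" for x
    by (simp add: u_def Q_def Q0_def gen_poly_diff distrib_left)
  \<comment> \<open>\<open>P\<close> is positive on \<open>K\<close>, so the convention
    \<open>0 * (-\<infinity>) = 0\<close> never applies.\<close>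
  have f_eq: "f x = (if Q x = 0 then -\<infinity> else ereal (r x))" if "x \<in> K" for x
    using pos[OF that] by (simp add: f_def r_def elog_def)
  have r_le: "r x \<le> u x" if "x \<in> K" "Q x \<noteq> 0" for x
    unfolding r_def u_eq using pos[OF that(1)] that(2) by (intro mult_left_mono ln_tangent_le) auto
  have f_le: "f x \<le> ereal (u x)" if "x \<in> K" for x
    using f_eq[OF that] r_le[OF that] by simp
  have spM: "space M = K" by (simp add: M_def)
  \<comment> \<open>The positive part of \<open>f\<close> is dominated by that of the integrable
    \<open>u\<close>, so only the negative part can diverge.\<close>
  have "(\<integral>\<^sup>+ x. e2ennreal (f x) \<partial>M) \<le> (\<integral>\<^sup>+ x. ennreal (u x) \<partial>M)"
    using e2ennreal_mono[OF f_le] spM by (intro nn_integral_mono) simp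
  moreover have "(\<integral>\<^sup>+ x. ennreal (u x) \<partial>M) \<noteq> \<infinity>"
    using u_int by (simp add: real_integrable_def)
  ultimately have fpos: "(\<integral>\<^sup>+ x. e2ennreal (f x) \<partial>M) \<noteq> \<infinity>"
    by (metis infinity_ennreal_def top.extremum_unique)
  have J: "Jfun K \<alpha> c p q = ereal (c \<bullet> q) - ext_integral M f"
    by (simp add: Jfun_def f_def P_def Q_def M_def)
  show ?thesis
  proof (cases "(\<integral>\<^sup>+ x. e2ennreal (- f x) \<partial>M) = \<infinity>")
    case True
    then have "ext_integral M f = -\<infinity>" by (rule ext_integral_minus_infinity[OF fpos])
    then show ?thesis unfolding J Jfun_eq_phi[OF q0] by simp
  next
    case False
    \<comment> \<open>\<open>- f\<close> is infinite wherever \<open>Q\<close> vanishes, so a finite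
      integral of the negative part forces \<open>Q \<noteq> 0\<close> almost everywhere.\<close>
    have "AE x in M. e2ennreal (- f x) \<noteq> \<infinity>"
      by (rule nn_integral_noteq_infinite[OF _ False]) measurable
    then have Qnz: "AE x in M. Q x \<noteq> 0"
      using AE_space by eventually_elim (use f_eq spM in force)
    then have f_real: "AE x in M. f x = ereal (r x)"
      using AE_space by eventually_elim (use f_eq spM in force)
    have "(\<integral>\<^sup>+ x. e2ennreal (f x) \<partial>M) = (\<integral>\<^sup>+ x. ennreal (r x) \<partial>M)"
      "(\<integral>\<^sup>+ x. e2ennreal (- f x) \<partial>M) = (\<integral>\<^sup>+ x. ennreal (- r x) \<partial>M)"
      using f_real by (auto intro!: nn_integral_cong_AE)
    then have r_int: "integrable M r"
      using fpos False by (simp add: real_integrable_def r_meas)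
    have ext: "ext_integral M f = ereal (integral\<^sup>L M r)"
      by (rule ext_integral_AE_real[OF r_int f_real])
    have le: "AE x in M. 0 \<le> u x - r x"
      using Qnz AE_space by eventually_elim (use r_le spM in force)
    \<comment> \<open>Otherwise the tangent inequality would be an equality almost everywhere, hence
      \<open>Q = Q0\<close> almost everywhere and \<open>q = q0\<close> by linear
      independence.\<close>
    have "integral\<^sup>L M (\<lambda>x. u x - r x) \<noteq> 0"
    proof
      assume "integral\<^sup>L M (\<lambda>x. u x - r x) = 0"
      then have "AE x in M. u x - r x = 0"
        using integral_nonneg_eq_0_iff_AE[OF _ le] u_int r_int by simp
      then have "AE x in M. gen_poly \<alpha> (q - q0) x = 0"
        using Qnz AE_space
      proof eventually_elim
        case (elim x)
        then have "P x > 0" "Q0 x > 0" "Q x > 0" using pos[of x] spM by auto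
        with elim show ?case
          using ln_tangent_eq[of "Q x" "Q0 x"]
          unfolding u_eq r_def gen_poly_diff Q_def[symmetric] Q0_def[symmetric] by simp
      qed
      then have "q - q0 = 0" unfolding M_def by (rule gen_poly_AE_0_imp_0)
      then show False using ne by simp
    qed
    moreover have "integral\<^sup>L M (\<lambda>x. u x - r x) \<ge> 0"
      by (rule integral_nonneg_AE[OF le])
    ultimately have "integral\<^sup>L M r < integral\<^sup>L M u"
      using u_int r_int by simp
    then show ?thesis unfolding J Jfun_eq_phi[OF q0] ext u_val by simp
  qed
qed

section \<open>Existence of stationary points\<close>

lemma pos_cone_add_closure:
  assumes "e \<in> pos_cone K \<alpha>" "q \<in> closure (pos_cone K \<alpha>)" "t > 0"
  shows "t *\<^sub>R e + q \<in> pos_cone K \<alpha>"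
  using pos_coneD[OF assms(1)] closure_pos_cone_nonneg[OF assms(2)] assms(3)
  by (auto simp: pos_cone_def gen_poly_linear intro!: add_pos_nonneg)

lemma closure_pos_cone_scaleR:
  assumes "q \<in> closure (pos_cone K \<alpha>)" "t > 0"
  shows "t *\<^sub>R q \<in> closure (pos_cone K \<alpha>)"
proof -
  have "(*\<^sub>R) t ` pos_cone K \<alpha> \<subseteq> pos_cone K \<alpha>"
    using assms(2) by (auto simp: pos_cone_def gen_poly_linear)
  then have "closure ((*\<^sub>R) t ` pos_cone K \<alpha>) \<subseteq> closure (pos_cone K \<alpha>)"
    by (rule closure_mono)
  then show ?thesis using assms(1) closure_scaleR[of t "pos_cone K \<alpha>"] by auto
qed

section \<open>Continuity and coercivity of the functional\<close>

lemma continuous_phi: "continuous_on (pos_cone K \<alpha>) (phi c p)"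
proof -
  have "continuous_on (pos_cone K \<alpha> \<times> K)
      (\<lambda>z. gen_poly \<alpha> p (snd z) * ln (gen_poly \<alpha> (fst z) (snd z)))"
    by (intro continuous_on_mult continuous_on_ln continuous_gen_poly_pair continuous_on_snd
        continuous_on_id continuous_on_compose2[OF continuous_gen_poly]) (force dest: pos_coneD)+
  then have "continuous_on (pos_cone K \<alpha>)
      (\<lambda>q. \<integral>x. gen_poly \<alpha> p x * ln (gen_poly \<alpha> q x) \<partial>lebesgue_on K)"
    by (rule continuous_on_parametric_integral[OF compact_K,
        where F = "\<lambda>q x. gen_poly \<alpha> p x * ln (gen_poly \<alpha> q x)"])
  then show ?thesis
    unfolding phi_def [abs_def] by (intro continuous_on_diff continuous_on_inner continuous_on_const continuous_on_id)
qed

lemma continuous_mom: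
  assumes "continuous_on K A" "q \<in> pos_cone K \<alpha>"
  shows "isCont (mom A m) q"
  using mom_has_derivative[OF assms] has_derivative_continuous by blast

text \<open>By compactness \<open>c\<close> has a positive minimum on the unit vectors of the closed
  cone, and homogeneity extends the bound. Normalizing \<open>p\<close> shows that such unit vectors
  exist.\<close>

lemma dual_cone_coercive:
  assumes c: "c \<in> dual_cone K \<alpha>" and p: "p \<in> pos_cone K \<alpha>"
  obtains \<epsilon> where "\<epsilon> > 0" "\<And>q. q \<in> closure (pos_cone K \<alpha>) \<Longrightarrow> c \<bullet> q \<ge> \<epsilon> * norm q"
proof -
  let ?S = "closure (pos_cone K \<alpha>) \<inter> sphere 0 1"
  have sgn: "inverse (norm q) *\<^sub>R q \<in> ?S" if "q \<in> closure (pos_cone K \<alpha>)" "q \<noteq> 0" for q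
    using that closure_pos_cone_scaleR by simp
  have "p \<noteq> 0" using p zero_notin_pos_cone by blast
  then have "?S \<noteq> {}" using sgn[of p] p closure_subset by blast
  moreover have "compact ?S" by (intro closed_Int_compact) auto
  moreover have "continuous_on ?S (\<lambda>z. c \<bullet> z)" by (intro continuous_intros)
  ultimately obtain y where y: "y \<in> ?S" "\<And>z. z \<in> ?S \<Longrightarrow> c \<bullet> y \<le> c \<bullet> z"
    using continuous_attains_inf[of ?S "\<lambda>z. c \<bullet> z"] by blast
  have "c \<bullet> y > 0" using c y(1) unfolding dual_cone_def by auto
  moreover have "c \<bullet> q \<ge> (c \<bullet> y) * norm q" if q: "q \<in> closure (pos_cone K \<alpha>)" for q
  proof (cases "q = 0")
    case False
    then show ?thesis using y(2)[OF sgn[OF q False]] by (simp add: field_simps)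
  qed simp
  ultimately show ?thesis using that by blast
qed

text \<open>The logarithm is eventually below every increasing linear function:
  \<open>ln y \<le> s * y - (1 + ln s)\<close> with small \<open>s\<close> lets the integral cost
  only half of the linear growth of \<open>c \<bullet> q\<close>.\<close>

lemma phi_coercive:
  assumes c: "c \<in> dual_cone K \<alpha>" and p: "p \<in> pos_cone K \<alpha>"
  obtains \<epsilon> C where "\<epsilon> > 0" "\<And>q. q \<in> pos_cone K \<alpha> \<Longrightarrow> phi c p q \<ge> \<epsilon> * norm q - C"
proof -
  obtain \<epsilon> where \<epsilon>: "\<epsilon> > 0" "\<And>q. q \<in> closure (pos_cone K \<alpha>) \<Longrightarrow> c \<bullet> q \<ge> \<epsilon> * norm q"
    using dual_cone_coercive[OF c p] by blast
  obtain L where L: "L > 0" "\<And>q x. x \<in> K \<Longrightarrow> \<bar>gen_poly \<alpha> q x\<bar> \<le> L * norm q"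
    using gen_poly_bound by blast
  \<comment> \<open>\<open>D * norm q\<close> bounds the integral of the product of the two
    polynomials, and \<open>s\<close> is chosen so that \<open>s * D\<close> is at most half of
    \<open>\<epsilon>\<close>; \<open>D + 1\<close> keeps its denominator positive.\<close>
  define D where "D = (L * norm p) * L * measure lebesgue K"
  have "D \<ge> 0" using L(1) by (simp add: D_def)
  define s where "s = \<epsilon> / (2 * (D + 1))"
  have s: "s > 0" "s * D \<le> \<epsilon> / 2"
    using \<epsilon>(1) \<open>D \<ge> 0\<close> by (simp_all add: s_def field_simps)
  define C where "C = - (1 + ln s) * (\<integral>x. gen_poly \<alpha> p x \<partial>lebesgue_on K)"
  have "phi c p q \<ge> \<epsilon> / 2 * norm q - C" if q: "q \<in> pos_cone K \<alpha>" for q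
  proof -
    have int: "integrable (lebesgue_on K) (gen_poly \<alpha> p)"
      "integrable (lebesgue_on K) (\<lambda>x. gen_poly \<alpha> p x * gen_poly \<alpha> q x)"
      by (intro integrable_continuous_on_compact compact_K continuous_intros continuous_gen_poly)+
    have "(\<integral>x. gen_poly \<alpha> p x * ln (gen_poly \<alpha> q x) \<partial>lebesgue_on K)
        \<le> (\<integral>x. s * (gen_poly \<alpha> p x * gen_poly \<alpha> q x) + (- (1 + ln s)) * gen_poly \<alpha> p x \<partial>lebesgue_on K)"
    proof (rule integral_mono[OF integrable_P_ln[OF q]])
      fix x assume "x \<in> space (lebesgue_on K)"
      then have pos: "gen_poly \<alpha> p x > 0" "gen_poly \<alpha> q x > 0" using p q pos_coneD by auto
      have "ln (gen_poly \<alpha> q x) \<le> s * gen_poly \<alpha> q x - (1 + ln s)"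
        using ln_le_minus_one[of "s * gen_poly \<alpha> q x"] pos s by (simp add: ln_mult)
      from mult_left_mono[OF this less_imp_le[OF pos(1)]]
      show "gen_poly \<alpha> p x * ln (gen_poly \<alpha> q x)
          \<le> s * (gen_poly \<alpha> p x * gen_poly \<alpha> q x) + (- (1 + ln s)) * gen_poly \<alpha> p x"
        by (simp add: algebra_simps)
    qed (intro Bochner_Integration.integrable_add integrable_mult_right int)
    also have "\<dots> = s * (\<integral>x. gen_poly \<alpha> p x * gen_poly \<alpha> q x \<partial>lebesgue_on K) + C"
      unfolding C_def using int by simp
    also have "\<dots> \<le> s * (D * norm q) + C"
    proof -
      have "\<bar>\<integral>x. gen_poly \<alpha> p x * gen_poly \<alpha> q x \<partial>lebesgue_on K\<bar>
          \<le> ((L * norm p) * (L * norm q)) * measure lebesgue K"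
        using L by (intro integral_abs_le_measure compact_K continuous_intros continuous_gen_poly)
          (auto simp: abs_mult intro!: mult_mono)
      also have "\<dots> = D * norm q" by (simp add: D_def)
      finally show ?thesis using s(1) by (intro add_right_mono mult_left_mono) auto
    qed
    also have "\<dots> \<le> \<epsilon> / 2 * norm q + C"
      using mult_right_mono[OF s(2) norm_ge_zero[of q]] by (simp add: mult.assoc)
    finally have "phi c p q \<ge> c \<bullet> q - (\<epsilon> / 2 * norm q + C)" by (simp add: phi_def)
    moreover have "c \<bullet> q \<ge> \<epsilon> * norm q" using \<epsilon>(2) q closure_subset by blast
    ultimately show ?thesis by simp
  qed
  then show ?thesis using that[of "\<epsilon> / 2" C] \<epsilon>(1) by simp
qed

text \<open>\<open>phi c p\<close> is convex, so its slope at the far endpoint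
  \<open>q + s *\<^sub>R v\<close> is at least the difference quotient, which \<open>le\<close>
  makes nonnegative. The tangent is taken at that endpoint so that the bound concerns the moment
  there.\<close>

lemma mom_le_of_phi_le:
  assumes p: "p \<in> pos_cone K \<alpha>" and q: "q \<in> pos_cone K \<alpha>" and qv: "q + s *\<^sub>R v \<in> pos_cone K \<alpha>"
    and s: "s > 0" and le: "phi c p q \<le> phi c p (q + s *\<^sub>R v)"
  shows "mom (\<lambda>x. gen_poly \<alpha> p x * gen_poly \<alpha> v x) 1 (q + s *\<^sub>R v) \<le> c \<bullet> v"
proof -
  let ?P = "gen_poly \<alpha> p" and ?Q = "gen_poly \<alpha> q" and ?Z = "gen_poly \<alpha> (q + s *\<^sub>R v)"
    and ?V = "gen_poly \<alpha> v"
  have int: "integrable (lebesgue_on K) (\<lambda>x. ?P x * ?V x / ?Z x ^ 1)"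
    by (intro integrable_mom_integrand qv continuous_intros continuous_gen_poly)
  have "(\<integral>x. ?P x * ln (?Q x) \<partial>lebesgue_on K)
      \<le> (\<integral>x. ?P x * ln (?Z x) - s * (?P x * ?V x / ?Z x ^ 1) \<partial>lebesgue_on K)"
  proof (rule integral_mono[OF integrable_P_ln[OF q]])
    fix x assume "x \<in> space (lebesgue_on K)"
    then have pos: "?P x > 0" "?Q x > 0" "?Z x > 0" using p q qv pos_coneD by auto
    have "ln (?Q x) \<le> ln (?Z x) + (?Q x - ?Z x) / ?Z x"
      using pos by (intro ln_tangent_le)
    from mult_left_mono[OF this less_imp_le[OF pos(1)]]
    show "?P x * ln (?Q x) \<le> ?P x * ln (?Z x) - s * (?P x * ?V x / ?Z x ^ 1)"
      by (simp add: gen_poly_linear algebra_simps)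
  qed (intro Bochner_Integration.integrable_diff integrable_mult_right int integrable_P_ln qv)
  also have "\<dots> = (\<integral>x. ?P x * ln (?Z x) \<partial>lebesgue_on K)
      - s * mom (\<lambda>x. ?P x * ?V x) 1 (q + s *\<^sub>R v)"
    unfolding mom_def using int integrable_P_ln[OF qv, of p]
    by (simp del: times_divide_eq_right)
  finally have "s * mom (\<lambda>x. ?P x * ?V x) 1 (q + s *\<^sub>R v) \<le> s * (c \<bullet> v)"
    using le by (simp add: phi_def inner_add_right)
  then show ?thesis using s by simp
qed

text \<open>\<open>mom_le_of_phi_le\<close> along \<open>v\<close>, with steps tending to 0, gives
  one inequality in the limit; \<open>- v\<close> gives the reverse one.\<close>

lemma minimum_imp_stationary:
  assumes p: "p \<in> pos_cone K \<alpha>" and q: "q \<in> pos_cone K \<alpha>"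
    and min: "\<And>y. y \<in> pos_cone K \<alpha> \<Longrightarrow> phi c p q \<le> phi c p y"
  shows "stationary c p q"
proof -
  have le: "mom (\<lambda>x. gen_poly \<alpha> p x * gen_poly \<alpha> v x) 1 q \<le> c \<bullet> v" for v
  proof (rule tendsto_upperbound)
    let ?z = "\<lambda>n. q + inverse (real (Suc n)) *\<^sub>R v"
    have z: "?z \<longlonglongrightarrow> q"
      using tendsto_add[OF tendsto_const[of q] tendsto_scaleR[OF LIMSEQ_inverse_real_of_nat tendsto_const[of v]]]
      by simp
    have "isCont (mom (\<lambda>x. gen_poly \<alpha> p x * gen_poly \<alpha> v x) 1) q"
      by (intro continuous_mom q continuous_intros continuous_gen_poly)
    then show "(\<lambda>n. mom (\<lambda>x. gen_poly \<alpha> p x * gen_poly \<alpha> v x) 1 (?z n))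
        \<longlonglongrightarrow> mom (\<lambda>x. gen_poly \<alpha> p x * gen_poly \<alpha> v x) 1 q"
      using z isCont_tendsto_compose by blast
    have "\<forall>\<^sub>F n in sequentially. ?z n \<in> pos_cone K \<alpha>"
      using topological_tendstoD[OF z open_pos_cone q] .
    then show "\<forall>\<^sub>F n in sequentially. mom (\<lambda>x. gen_poly \<alpha> p x * gen_poly \<alpha> v x) 1 (?z n) \<le> c \<bullet> v"
      by eventually_elim (intro mom_le_of_phi_le p q min, simp_all)
  qed simp
  have "mom (\<lambda>x. gen_poly \<alpha> p x * gen_poly \<alpha> (- v) x) 1 q
      = - mom (\<lambda>x. gen_poly \<alpha> p x * gen_poly \<alpha> v x) 1 q" for v
    by (simp add: mom_def gen_poly_minus)
  then show ?thesis
    unfolding stationary_def using le le[of "- v" for v] by (force intro: antisym)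
qed

text \<open>Minimize over the shifted cones \<open>t p + closure P+ \<subseteq> P+\<close>, where the functional is real-valued and
  continuous, and let \<open>t \<rightarrow> 0\<close>.  Testing minimality in the direction \<open>p\<close> bounds \<open>\<integral> 1 / Z\<^sub>n\<close>
  uniformly, so by Fatou \<open>\<integral> 1 / Q < \<infinity>\<close> for the limit, which therefore is not on the boundary.\<close>

lemma exists_stationary:
  assumes c: "c \<in> dual_cone K \<alpha>" and p: "p \<in> pos_cone K \<alpha>"
    and boundary: "\<And>q. q \<in> closure (pos_cone K \<alpha>) - pos_cone K \<alpha> \<Longrightarrow>
            (\<integral>\<^sup>+ x. 1 / ennreal (gen_poly \<alpha> q x) \<partial>(lebesgue_on K)) = \<infinity>"
  obtains q where "q \<in> pos_cone K \<alpha>" "stationary c p q"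
proof -
  let ?C = "closure (pos_cone K \<alpha>)"
  obtain \<epsilon> C where coer: "\<epsilon> > 0" "\<And>q. q \<in> pos_cone K \<alpha> \<Longrightarrow> phi c p q \<ge> \<epsilon> * norm q - C"
    using phi_coercive[OF c p] by blast
  \<comment> \<open>Coercivity confines every point not worse than \<open>p\<close> to the ball of
    radius \<open>R\<close>, which does not depend on the shift of the cone.\<close>
  define R where "R = (phi c p p + C) / \<epsilon>"
  have R: "norm q \<le> R" if "q \<in> pos_cone K \<alpha>" "phi c p q \<le> phi c p p" for q
    using coer(2)[OF that(1)] that(2) coer(1) by (simp add: R_def field_simps)
  \<comment> \<open>Starting at 1/2 keeps \<open>t n < 1\<close>, so that
    \<open>p = t n *\<^sub>R p + (1 - t n) *\<^sub>R p\<close> is a competitor in every shifted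
    cone.\<close>
  define t where "t n = inverse (real (Suc (Suc n)))" for n
  have t: "0 < t n" "t n < 1" for n by (simp_all add: t_def inverse_less_1_iff)
  have t_lim: "t \<longlonglongrightarrow> 0"
    unfolding t_def using LIMSEQ_Suc[OF LIMSEQ_inverse_real_of_nat] .
  define S where "S n = (+) (t n *\<^sub>R p) ` ?C" for n
  have S_sub: "S n \<subseteq> pos_cone K \<alpha>" for n
    unfolding S_def using pos_cone_add_closure[OF p _ t(1)] by blast
  have S_add: "t n *\<^sub>R p + y \<in> S n" if "y \<in> pos_cone K \<alpha>" for n y
    unfolding S_def using that closure_subset by blast
  have pS: "p \<in> S n" for n
  proof -
    have "(1 - t n) *\<^sub>R p \<in> pos_cone K \<alpha>"
      using p t(2) by (auto simp: pos_cone_def gen_poly_linear)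
    then show ?thesis using S_add[of "(1 - t n) *\<^sub>R p" n] by (simp add: algebra_simps)
  qed
  have "\<exists>q\<in>S n. \<forall>y\<in>S n. phi c p q \<le> phi c p y" for n
  proof -
    let ?B = "S n \<inter> cball 0 R"
    have "compact ?B"
      unfolding S_def by (intro closed_Int_compact closed_translation) auto
    moreover have "p \<in> ?B" using pS R[OF p] by simp
    moreover have "continuous_on ?B (phi c p)"
      using continuous_on_subset[OF continuous_phi] S_sub by blast
    ultimately obtain q where q: "q \<in> ?B" "\<forall>y\<in>?B. phi c p q \<le> phi c p y"
      using continuous_attains_inf[of ?B "phi c p"] by blast
    have "phi c p q \<le> phi c p y" if "y \<in> S n" for y
    proof (cases "phi c p y \<le> phi c p p")
      case True
      then show ?thesis using q(2) R[of y] that S_sub[of n] by auto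
    next
      case False
      then show ?thesis using q(2)[rule_format, OF \<open>p \<in> ?B\<close>] by simp
    qed
    then show ?thesis using q(1) by blast
  qed
  then obtain q where q: "\<And>n. q n \<in> S n" "\<And>n y. y \<in> S n \<Longrightarrow> phi c p (q n) \<le> phi c p y"
    by metis
  have q_pos: "q n \<in> pos_cone K \<alpha>" for n using q(1) S_sub by blast
  have "q n \<in> cball 0 R" for n using R[OF q_pos q(2)[OF pS]] by simp
  then obtain l r where r: "strict_mono r" "(q \<circ> r) \<longlonglongrightarrow> l"
    using compact_cball[of 0 R] unfolding compact_def by metis
  have lC: "l \<in> ?C"
    using r(2) q_pos unfolding closure_sequential by (intro exI[of _ "q \<circ> r"]) simp
  \<comment> \<open>One more step along \<open>p\<close> from the minimizer stays in the shifted
    cone and has the same limit; \<open>mom_le_of_phi_le\<close> then bounds the moment at its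
    endpoint \<open>z n\<close>.\<close>
  define z where "z n = q (r n) + t (r n) *\<^sub>R p" for n
  have t_r: "(\<lambda>n. t (r n)) \<longlonglongrightarrow> 0"
    using LIMSEQ_subseq_LIMSEQ[OF t_lim r(1)] by (simp add: comp_def)
  have z_lim: "z \<longlonglongrightarrow> l"
    unfolding z_def using tendsto_add[OF r(2) tendsto_scaleR[OF t_r tendsto_const[of p]]]
    by (simp add: comp_def)
  have zS: "z n \<in> S (r n)" for n
  proof -
    obtain y where y: "y \<in> ?C" "q (r n) = t (r n) *\<^sub>R p + y" using q(1) unfolding S_def by blast
    have "t (r n) *\<^sub>R p + y \<in> pos_cone K \<alpha>" by (rule pos_cone_add_closure[OF p y(1) t(1)])
    from S_add[OF this, of "r n"] show ?thesis
      unfolding z_def y(2) by (subst add.commute)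
  qed
  have z_pos: "z n \<in> pos_cone K \<alpha>" for n using zS S_sub by blast
  have mom_z: "mom (\<lambda>x. gen_poly \<alpha> p x * gen_poly \<alpha> p x) 1 (z n) \<le> c \<bullet> p" for n
    using mom_le_of_phi_le[OF p q_pos, of "r n" "t (r n)" p c] z_pos[of n] q(2)[OF zS[of n]] t(1)
    unfolding z_def by simp
  obtain \<delta> where \<delta>: "\<delta> > 0" "\<And>x. x \<in> K \<Longrightarrow> gen_poly \<alpha> p x \<ge> \<delta>"
    using pos_cone_lower_bound[OF p] by blast
  \<comment> \<open>\<open>P \<ge> \<delta>\<close> gives
    \<open>1 / Z \<le> P\<^sup>2 / (\<delta>\<^sup>2 * Z)\<close>, whose integral is the moment just
    bounded, divided by \<open>\<delta>\<^sup>2\<close>.\<close>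
  have nn_z: "(\<integral>\<^sup>+ x. 1 / ennreal (gen_poly \<alpha> (z n) x) \<partial>lebesgue_on K) \<le> ennreal ((c \<bullet> p) / \<delta>\<^sup>2)" for n
  proof -
    let ?Z = "gen_poly \<alpha> (z n)" and ?P = "gen_poly \<alpha> p"
    have int: "integrable (lebesgue_on K) (\<lambda>x. ?P x * ?P x / ?Z x ^ 1)"
      by (intro integrable_mom_integrand z_pos continuous_intros continuous_gen_poly)
    have "(\<integral>\<^sup>+ x. 1 / ennreal (?Z x) \<partial>lebesgue_on K)
        \<le> (\<integral>\<^sup>+ x. ennreal (1 / \<delta>\<^sup>2 * (?P x * ?P x / ?Z x ^ 1)) \<partial>lebesgue_on K)"
    proof (rule nn_integral_mono)
      fix x assume "x \<in> space (lebesgue_on K)"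
      then have x: "x \<in> K" by simp
      have Z: "?Z x > 0" using z_pos pos_coneD x by blast
      have "\<delta>\<^sup>2 \<le> ?P x * ?P x"
        using \<delta>(1) \<delta>(2)[OF x] by (simp add: power2_eq_square mult_mono)
      then have "1 / ?Z x \<le> 1 / \<delta>\<^sup>2 * (?P x * ?P x / ?Z x ^ 1)"
        using Z \<delta>(1) by (simp add: field_simps)
      then show "1 / ennreal (?Z x) \<le> ennreal (1 / \<delta>\<^sup>2 * (?P x * ?P x / ?Z x ^ 1))"
        using Z by (metis divide_ennreal ennreal_1 ennreal_leI zero_le_one)
    qed
    also have "\<dots> = ennreal (\<integral>x. 1 / \<delta>\<^sup>2 * (?P x * ?P x / ?Z x ^ 1) \<partial>lebesgue_on K)"
      using pos_coneD[OF z_pos[of n]]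
      by (intro nn_integral_eq_integral integrable_mult_right int AE_I2)
        (auto intro!: divide_nonneg_nonneg mult_nonneg_nonneg simp: less_imp_le)
    also have "(\<integral>x. 1 / \<delta>\<^sup>2 * (?P x * ?P x / ?Z x ^ 1) \<partial>lebesgue_on K)
        = 1 / \<delta>\<^sup>2 * mom (\<lambda>x. ?P x * ?P x) 1 (z n)"
      unfolding mom_def by (rule integral_mult_right_zero)
    also have "\<dots> \<le> (c \<bullet> p) / \<delta>\<^sup>2"
      using mom_z[of n] \<delta>(1) by (simp add: divide_right_mono)
    finally show ?thesis by (simp add: ennreal_leI)
  qed
  have "(\<integral>\<^sup>+ x. 1 / ennreal (gen_poly \<alpha> l x) \<partial>lebesgue_on K)
      = (\<integral>\<^sup>+ x. liminf (\<lambda>n. 1 / ennreal (gen_poly \<alpha> (z n) x)) \<partial>lebesgue_on K)"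
  proof (rule nn_integral_cong)
    fix x
    have "(\<lambda>n. gen_poly \<alpha> (z n) x) \<longlonglongrightarrow> gen_poly \<alpha> l x"
      unfolding gen_poly_inner by (intro tendsto_intros z_lim)
    then have "(\<lambda>n. ennreal (gen_poly \<alpha> (z n) x)) \<longlonglongrightarrow> ennreal (gen_poly \<alpha> l x)"
      by (rule tendsto_ennrealI)
    \<comment> \<open>Inversion on \<open>ennreal\<close> is continuous at 0 too, with value
      \<open>\<infinity>\<close>, so the pointwise limit also holds at zeros of the limit
      function.\<close>
    moreover have "continuous_on UNIV (\<lambda>y :: ennreal. inverse y)"
      by (intro continuous_on_inverse_ennreal continuous_on_id)
    ultimately have "(\<lambda>n. inverse (ennreal (gen_poly \<alpha> (z n) x))) \<longlonglongrightarrow> inverse (ennreal (gen_poly \<alpha> l x))"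
      using continuous_on_tendsto_compose by fastforce
    then show "1 / ennreal (gen_poly \<alpha> l x) = liminf (\<lambda>n. 1 / ennreal (gen_poly \<alpha> (z n) x))"
      unfolding divide_ennreal_def mult_1 by (rule lim_imp_Liminf[OF sequentially_bot, symmetric])
  qed
  also have "\<dots> \<le> liminf (\<lambda>n. \<integral>\<^sup>+ x. 1 / ennreal (gen_poly \<alpha> (z n) x) \<partial>lebesgue_on K)"
    by (rule nn_integral_liminf) measurable
  also have "\<dots> \<le> ennreal ((c \<bullet> p) / \<delta>\<^sup>2)"
    using nn_z by (intro Liminf_le) auto
  also have "\<dots> < \<infinity>" by simp
  finally have l: "l \<in> pos_cone K \<alpha>"
    using boundary[of l] lC by fastforce
  \<comment> \<open>Every \<open>y\<close> in the open cone is the limit of the competitors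
    \<open>t (r n) *\<^sub>R p + y\<close> in the shifted cones, so minimality passes to the
    limit.\<close>
  have "phi c p l \<le> phi c p y" if y: "y \<in> pos_cone K \<alpha>" for y
  proof (rule LIMSEQ_le)
    have cont: "isCont (phi c p) w" if "w \<in> pos_cone K \<alpha>" for w
      using continuous_phi open_pos_cone that continuous_on_eq_continuous_at by blast
    show "(\<lambda>n. phi c p ((q \<circ> r) n)) \<longlonglongrightarrow> phi c p l"
      by (rule isCont_tendsto_compose[OF cont[OF l] r(2)])
    have "(\<lambda>n. t (r n) *\<^sub>R p + y) \<longlonglongrightarrow> y"
      using tendsto_add[OF tendsto_scaleR[OF t_r tendsto_const[of p]] tendsto_const[of y]] by simp
    then show "(\<lambda>n. phi c p (t (r n) *\<^sub>R p + y)) \<longlonglongrightarrow> phi c p y"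
      by (rule isCont_tendsto_compose[OF cont[OF y]])
    show "\<exists>N. \<forall>n\<ge>N. phi c p ((q \<circ> r) n) \<le> phi c p (t (r n) *\<^sub>R p + y)"
      using q(2) S_add[OF y] by auto
  qed
  then have "stationary c p l" by (rule minimum_imp_stationary[OF p l])
  then show ?thesis using that l by blast
qed

end

section \<open>The minimizer map and its inverse\<close>

lemma matrix_inv_mult_vec:
  fixes M :: "real^'k^'k"
  assumes "invertible M"
  shows "M *v (matrix_inv M *v v) = v" "matrix_inv M *v (M *v v) = v"
proof -
  have "M ** matrix_inv M = mat 1 \<and> matrix_inv M ** M = mat 1"
    using someI_ex[OF assms[unfolded invertible_def]] unfolding matrix_inv_def .
  then show "M *v (matrix_inv M *v v) = v" "matrix_inv M *v (M *v v) = v"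
    by (simp_all add: matrix_vector_mul_assoc)
qed

section \<open>Gram matrices and the stationarity equation\<close>

context moment_problem
begin

text \<open>Weight 1 and exponent 1 give the matrix of the stationarity equation; weight
  \<open>gen_poly \<alpha> p\<close> and exponent 2 give the one that arises from differentiating
  it.\<close>

definition gram :: "(real^'d \<Rightarrow> real) \<Rightarrow> nat \<Rightarrow> real^'n \<Rightarrow> real^'n^'n" where
  "gram A m q = (\<chi> i j. mom (\<lambda>x. A x * \<alpha> i x * \<alpha> j x) m q)"

lemma gram_mult:
  assumes "continuous_on K A" "q \<in> pos_cone K \<alpha>"
  shows "(gram A m q *v v) $ i = mom (\<lambda>x. A x * \<alpha> i x * gen_poly \<alpha> v x) m q"
  using mom_gen_poly[of "\<lambda>x. A x * \<alpha> i x" q v m] assms continuous_alpha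
  by (simp add: gram_def matrix_vector_mult_def continuous_on_mult mult.commute)

lemma gram_mult_inner:
  assumes "continuous_on K A" "q \<in> pos_cone K \<alpha>"
  shows "v \<bullet> (gram A m q *v v) = mom (\<lambda>x. A x * (gen_poly \<alpha> v x)\<^sup>2) m q"
proof -
  have "mom (\<lambda>x. A x * (gen_poly \<alpha> v x)\<^sup>2) m q
      = mom (\<lambda>x. (A x * gen_poly \<alpha> v x) * gen_poly \<alpha> v x) m q"
    by (simp add: power2_eq_square mult.assoc)
  also have "\<dots> = (\<Sum>j\<in>UNIV. v $ j * mom (\<lambda>x. A x * gen_poly \<alpha> v x * \<alpha> j x) m q)"
    by (intro mom_gen_poly assms continuous_intros continuous_gen_poly)
  also have "\<dots> = v \<bullet> (gram A m q *v v)"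
    by (simp add: inner_vec_def gram_mult[OF assms] mult_ac)
  finally show ?thesis ..
qed

text \<open>The quadratic form is the integral of \<open>(gen_poly \<alpha> v x)\<^sup>2\<close>
  against a positive weight; on the kernel it vanishes, so \<open>gen_poly \<alpha> v\<close> is 0
  almost everywhere and \<open>v = 0\<close>.\<close>

lemma gram_invertible:
  assumes A: "continuous_on K A" and pos: "\<And>x. x \<in> K \<Longrightarrow> A x > 0" and q: "q \<in> pos_cone K \<alpha>"
  shows "invertible (gram A m q)"
proof -
  have "v = 0" if "gram A m q *v v = 0" for v
  proof -
    let ?f = "\<lambda>x. A x * (gen_poly \<alpha> v x)\<^sup>2 / gen_poly \<alpha> q x ^ m"
    have int: "integrable (lebesgue_on K) ?f"
      by (intro integrable_mom_integrand q continuous_intros A continuous_gen_poly)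
    have nonneg: "AE x in lebesgue_on K. 0 \<le> ?f x"
      using pos pos_coneD[OF q] by (intro AE_I2) (simp add: less_imp_le)
    have "integral\<^sup>L (lebesgue_on K) ?f = 0"
      using gram_mult_inner[OF A q, of v m] that by (simp add: mom_def)
    then have "AE x in lebesgue_on K. ?f x = 0"
      using integral_nonneg_eq_0_iff_AE[OF int nonneg] by simp
    then have "AE x in lebesgue_on K. gen_poly \<alpha> v x = 0"
      using AE_space
    proof eventually_elim
      case (elim x)
      then show ?case using pos[of x] pos_coneD[OF q, of x] by simp
    qed
    then show "v = 0" by (rule gen_poly_AE_0_imp_0)
  qed
  then show ?thesis
    using matrix_left_invertible_ker invertible_left_inverse by blast
qed

lemmas gram_1_invertible = gram_invertible[OF continuous_on_const zero_less_one]

lemma gram_poly_invertible: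
  assumes "p \<in> pos_cone K \<alpha>" "q \<in> pos_cone K \<alpha>"
  shows "invertible (gram (gen_poly \<alpha> p) m q)"
  using assms pos_coneD by (intro gram_invertible continuous_gen_poly)

lemma stationary_iff_gram:
  assumes q: "q \<in> pos_cone K \<alpha>"
  shows "stationary c p q \<longleftrightarrow> gram (\<lambda>x. 1) 1 q *v p = c"
proof -
  have comp: "(gram (\<lambda>x. 1) 1 q *v p) $ i = mom (\<lambda>x. gen_poly \<alpha> p x * \<alpha> i x) 1 q" for i
    using gram_mult[OF continuous_on_const q, of 1 1 p i] by (simp add: mult.commute)
  have "mom (\<lambda>x. gen_poly \<alpha> p x * gen_poly \<alpha> v x) 1 q = (gram (\<lambda>x. 1) 1 q *v p) \<bullet> v" for v
    unfolding mom_gen_poly[OF continuous_gen_poly q] comp[symmetric] inner_vec_def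
    by (simp add: mult.commute)
  then show ?thesis
    unfolding stationary_def using vector_eq_rdot[of c "gram (\<lambda>x. 1) 1 q *v p"] by auto
qed

text \<open>Stationarity of \<open>q\<close> for \<open>p\<close> is linear in \<open>p\<close>; solving for \<open>p\<close> gives the inverse of \<open>gmap\<close>.\<close>

definition param_of :: "real^'n \<Rightarrow> real^'n \<Rightarrow> real^'n" where
  "param_of c q = matrix_inv (gram (\<lambda>x. 1) 1 q) *v c"

lemma gram_param_of: "q \<in> pos_cone K \<alpha> \<Longrightarrow> gram (\<lambda>x. 1) 1 q *v param_of c q = c"
  unfolding param_of_def by (intro matrix_inv_mult_vec gram_1_invertible)

lemma stationary_iff_param_of:
  assumes q: "q \<in> pos_cone K \<alpha>"
  shows "stationary c p q \<longleftrightarrow> p = param_of c q"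
  unfolding stationary_iff_gram[OF q]
proof
  assume "gram (\<lambda>x. 1) 1 q *v p = c"
  then show "p = param_of c q"
    unfolding param_of_def
    using matrix_inv_mult_vec(2)[OF gram_1_invertible[OF q], of 1 p] by simp
qed (simp only: gram_param_of[OF q])

text \<open>Used with \<open>G\<close> the identity for the smoothness of \<open>param_of\<close> and with \<open>G = gmap\<close> for that of \<open>gmap\<close>.\<close>

definition moment_gens :: "(real^'n \<Rightarrow> real^'n) \<Rightarrow> (real^'n \<Rightarrow> real) set" where
  "moment_gens G = {\<lambda>x. mom A m (G x) |A m. continuous_on K A}
     \<union> {\<lambda>x. x $ i |i. True} \<union> {\<lambda>x. G x $ i |i. True}"

section \<open>Algebraic expressions in moments and smoothness\<close>

lemma alg_closure_mom:
  "continuous_on K A \<Longrightarrow> alg_closure S (moment_gens G) (\<lambda>x. mom A m (G x))"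
  by (rule alg_closure.gen) (auto simp: moment_gens_def)

lemma alg_closure_coordinate: "alg_closure S (moment_gens G) (\<lambda>x. x $ i)"
  by (rule alg_closure.gen) (auto simp: moment_gens_def)

text \<open>The coefficients \<open>v x\<close> move with the point, so the moment is not itself a
  generator; linearity splits it into coordinates times generators.\<close>

lemma alg_closure_mom_gen_poly:
  assumes A: "continuous_on K A" and G: "\<And>x. x \<in> S \<Longrightarrow> G x \<in> pos_cone K \<alpha>"
    and v: "\<And>i. alg_closure S (moment_gens G) (\<lambda>x. v x $ i)"
  shows "alg_closure S (moment_gens G) (\<lambda>x. mom (\<lambda>y. A y * gen_poly \<alpha> (v x) y) m (G x))"
proof (rule alg_closure.cong)
  show "alg_closure S (moment_gens G)
      (\<lambda>x. \<Sum>j\<in>UNIV. v x $ j * mom (\<lambda>y. A y * \<alpha> j y) m (G x))"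
    by (intro alg_closure_sum alg_closure.mult v alg_closure_mom continuous_intros A continuous_alpha)
qed (rule mom_gen_poly[OF A G])

text \<open>By the chain rule the derivative of a moment at \<open>G x\<close> is again such a
  moment, with exponent \<open>m + 1\<close> and a polynomial factor with coefficients
  \<open>DG x v\<close>. Hence one derivative of \<open>G\<close> expressed within the class yields
  all higher ones.\<close>

lemma moment_gens_differentiable:
  assumes G: "\<And>x. x \<in> S \<Longrightarrow> G x \<in> pos_cone K \<alpha>"
    and der: "\<And>x. x \<in> S \<Longrightarrow> (G has_derivative DG x) (at x)"
    and alg: "\<And>v i. alg_closure S (moment_gens G) (\<lambda>x. DG x v $ i)"
    and b: "b \<in> moment_gens G"
  shows "alg_differentiable S (moment_gens G) b"
proof -
  consider A m where "b = (\<lambda>x. mom A m (G x))" "continuous_on K A"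
    | i where "b = (\<lambda>x. x $ i)" | i where "b = (\<lambda>x. G x $ i)"
    using b unfolding moment_gens_def by blast
  then show ?thesis
  proof cases
    case (1 A m)
    show ?thesis unfolding 1(1)
    proof (rule alg_differentiableI)
      fix x assume "x \<in> S"
      from has_derivative_compose[OF der[OF this] mom_has_derivative[OF 1(2) G[OF this]]]
      show "((\<lambda>x. mom A m (G x)) has_derivative
          (\<lambda>v. - real m * mom (\<lambda>y. A y * gen_poly \<alpha> (DG x v) y) (m + 1) (G x))) (at x)" .
    next
      show "alg_closure S (moment_gens G)
          (\<lambda>x. - real m * mom (\<lambda>y. A y * gen_poly \<alpha> (DG x v) y) (m + 1) (G x))" for v
        by (intro alg_closure.mult alg_closure.const alg_closure_mom_gen_poly 1(2) G alg)
    qed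
  next
    case (2 i)
    show ?thesis unfolding 2
      by (rule alg_differentiableI[where D = "\<lambda>_ v. v $ i"])
        (auto intro!: bounded_linear_imp_has_derivative bounded_linear_vec_nth alg_closure.const)
  next
    case (3 i)
    show ?thesis unfolding 3
      by (rule alg_differentiableI[where D = "\<lambda>x v. DG x v $ i"])
        (auto intro!: bounded_linear.has_derivative[OF bounded_linear_vec_nth] der alg)
  qed
qed

lemma alg_closure_gram:
  assumes "continuous_on K A"
  shows "alg_closure S (moment_gens G) (\<lambda>x. gram A m (G x) $ i $ j)"
  unfolding gram_def using assms
  by (simp add: alg_closure_mom continuous_on_mult continuous_alpha)

text \<open>Cramer's rule for \<open>gram (\<lambda>_. 1) 1 x *v f x = c\<close>. Agreement of
  \<open>f\<close> with \<open>param_of c\<close> on \<open>S\<close> suffices, so that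
  \<open>inv_into\<close> can be inserted for \<open>f\<close>.\<close>

lemma smooth_on_param_of:
  assumes "open S" "S \<subseteq> pos_cone K \<alpha>" and f: "\<And>x. x \<in> S \<Longrightarrow> f x = param_of c x"
  shows "smooth_on S f"
proof (rule alg_closure_vec_smooth[OF \<open>open S\<close>])
  show "alg_differentiable S (moment_gens (\<lambda>x. x)) b" if "b \<in> moment_gens (\<lambda>x. x)" for b
    using assms(2) that
    by (intro moment_gens_differentiable[where DG = "\<lambda>_ v. v"] has_derivative_ident alg_closure.const)
      auto
  show "alg_closure S (moment_gens (\<lambda>x. x)) (\<lambda>x. f x $ i)" for i
  proof (rule alg_closure_cramer)
    show "alg_closure S (moment_gens (\<lambda>x. x)) (\<lambda>x. gram (\<lambda>_. 1) 1 x $ i $ j)" for i j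
      by (rule alg_closure_gram[OF continuous_on_const])
    show "alg_closure S (moment_gens (\<lambda>x. x)) (\<lambda>x. c $ i)" for i
      by (rule alg_closure.const)
    fix x assume x: "x \<in> S"
    then have "x \<in> pos_cone K \<alpha>" using assms(2) by blast
    from gram_1_invertible[OF this, of 1] gram_param_of[OF this, of c]
    show "det (gram (\<lambda>_. 1) 1 x) \<noteq> 0" "gram (\<lambda>_. 1) 1 x *v f x = c"
      by (simp_all only: invertible_det_nz f[OF x] not_False_eq_True)
  qed
qed

lemma continuous_on_param_of: "continuous_on (pos_cone K \<alpha>) (param_of c)"
proof -
  have "Ck_on 0 (pos_cone K \<alpha>) (param_of c)"
    using smooth_on_param_of[OF open_pos_cone order_refl refl] unfolding smooth_on_def by blast
  then show ?thesis by simp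
qed

text \<open>Differentiability comes from \<open>smooth_on_param_of\<close>; the product rule for
  each row of the constant \<open>gram (\<lambda>x. 1) 1 q *v param_of c q\<close> then yields the
  equation for \<open>H\<close>.\<close>

lemma param_of_has_derivative:
  assumes q: "q \<in> pos_cone K \<alpha>"
  obtains H where "(param_of c has_derivative H) (at q)"
    "\<And>v. gram (\<lambda>x. 1) 1 q *v H v = gram (gen_poly \<alpha> (param_of c q)) 2 q *v v"
proof -
  have "param_of c differentiable (at q)"
  proof -
    have "Ck_on (Suc 0) (pos_cone K \<alpha>) (param_of c)"
      using smooth_on_param_of[OF open_pos_cone order_refl refl] unfolding smooth_on_def by blast
    then show ?thesis using q by simp
  qed
  then obtain H where H: "(param_of c has_derivative H) (at q)"
    unfolding differentiable_def by blast
  have "(gram (\<lambda>x. 1) 1 q *v H v) $ i = (gram (gen_poly \<alpha> (param_of c q)) 2 q *v v) $ i" for i v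
  proof -
    let ?a = "\<lambda>j x. \<alpha> i x * \<alpha> j x" and ?h = "param_of c"
    have cont: "continuous_on K (?a j)" for j
      by (intro continuous_intros continuous_alpha)
    have comp: "((\<lambda>q. ?h q $ j) has_derivative (\<lambda>v. H v $ j)) (at q)" for j
      by (rule bounded_linear.has_derivative[OF bounded_linear_vec_nth H])
    have "((\<lambda>q. \<Sum>j\<in>UNIV. mom (?a j) 1 q * ?h q $ j) has_derivative
        (\<lambda>v. \<Sum>j\<in>UNIV. mom (?a j) 1 q * H v $ j
          + (- real 1 * mom (\<lambda>x. ?a j x * gen_poly \<alpha> v x) (1 + 1) q) * ?h q $ j)) (at q)"
      by (intro has_derivative_sum has_derivative_mult mom_has_derivative cont q comp)
    moreover have "((\<lambda>q. \<Sum>j\<in>UNIV. mom (?a j) 1 q * ?h q $ j) has_derivative (\<lambda>v. 0)) (at q)"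
    proof (rule has_derivative_transform_within_open[OF has_derivative_const open_pos_cone q])
      fix y assume "y \<in> pos_cone K \<alpha>"
      from gram_param_of[OF this, of c] have "(gram (\<lambda>x. 1) 1 y *v ?h y) $ i = c $ i" by metis
      then show "c $ i = (\<Sum>j\<in>UNIV. mom (?a j) 1 y * ?h y $ j)"
        by (simp add: gram_def matrix_vector_mult_def)
    qed
    ultimately have "(\<lambda>v. \<Sum>j\<in>UNIV. mom (?a j) 1 q * H v $ j
          + (- real 1 * mom (\<lambda>x. ?a j x * gen_poly \<alpha> v x) (1 + 1) q) * ?h q $ j) = (\<lambda>v. 0)"
      by (rule has_derivative_unique)
    from fun_cong[OF this, of v]
    have "(\<Sum>j\<in>UNIV. mom (?a j) 1 q * H v $ j)
        = (\<Sum>j\<in>UNIV. ?h q $ j * mom (\<lambda>x. ?a j x * gen_poly \<alpha> v x) 2 q)"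
      by (simp add: sum_subtractf mult.commute numeral_2_eq_2)
    \<comment> \<open>Regrouped so that the sum over \<open>j\<close> assembles the polynomial with
      coefficients \<open>?h q\<close>, leaving \<open>v\<close> as the vector on which the new Gram
      matrix acts.\<close>
    also have "\<dots> = (\<Sum>j\<in>UNIV. ?h q $ j * mom (\<lambda>x. (\<alpha> i x * gen_poly \<alpha> v x) * \<alpha> j x) 2 q)"
      by (simp add: mult_ac)
    also have "\<dots> = mom (\<lambda>x. (\<alpha> i x * gen_poly \<alpha> v x) * gen_poly \<alpha> (?h q) x) 2 q"
      by (intro mom_gen_poly[symmetric] q continuous_intros continuous_alpha continuous_gen_poly)
    also have "\<dots> = (gram (gen_poly \<alpha> (?h q)) 2 q *v v) $ i"
      by (simp add: gram_mult[OF continuous_gen_poly q] mult_ac)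
    finally show ?thesis by (simp add: gram_def matrix_vector_mult_def)
  qed
  then show ?thesis using that[OF H] by (simp add: vec_eq_iff)
qed

text \<open>The derivative of \<open>g\<close> exists by the inverse function rule and equals
  \<open>D\<close>, whose components are algebraic in moments at \<open>g p\<close> and coordinates
  of \<open>p\<close>. This makes the generators for \<open>G = g\<close> differentiable within the
  class, and smoothness bootstraps.\<close>

lemma smooth_on_inverse_param_of:
  assumes g: "\<And>p. p \<in> pos_cone K \<alpha> \<Longrightarrow> g p \<in> pos_cone K \<alpha>"
    and right: "\<And>p. p \<in> pos_cone K \<alpha> \<Longrightarrow> param_of c (g p) = p"
    and T: "open T" "T \<subseteq> pos_cone K \<alpha>" "\<And>p. p \<in> pos_cone K \<alpha> \<Longrightarrow> g p \<in> T"
    and left: "\<And>q. q \<in> T \<Longrightarrow> g (param_of c q) = q"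
  shows "smooth_on (pos_cone K \<alpha>) g"
proof -
  let ?S = "pos_cone K \<alpha>"
  define D where "D p v = matrix_inv (gram (gen_poly \<alpha> p) 2 (g p)) *v (gram (\<lambda>x. 1) 1 (g p) *v v)"
    for p v
  have D_eq: "gram (gen_poly \<alpha> p) 2 (g p) *v D p v = gram (\<lambda>x. 1) 1 (g p) *v v" if "p \<in> ?S" for p v
    unfolding D_def using that by (intro matrix_inv_mult_vec gram_poly_invertible g)
  have der: "(g has_derivative D p) (at p)" if p: "p \<in> ?S" for p
  proof -
    obtain H where H: "(param_of c has_derivative H) (at (g p))"
      "\<And>v. gram (\<lambda>x. 1) 1 (g p) *v H v = gram (gen_poly \<alpha> (param_of c (g p))) 2 (g p) *v v"
      using param_of_has_derivative[OF g[OF p]] by blast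
    \<comment> \<open>Both sides have the same image under the invertible matrix
      \<open>gram (\<lambda>x. 1) 1 (g p)\<close>.\<close>
    have "H (D p v) = v" for v
      using H(2)[of "D p v"] D_eq[OF p, of v] right[OF p]
        matrix_inv_mult_vec(2)[OF gram_1_invertible[OF g[OF p]]] by metis
    then have "H \<circ> D p = id" by (simp add: fun_eq_iff)
    from has_derivative_inverse_strong[OF T(1) T(3)[OF p]
        continuous_on_subset[OF continuous_on_param_of T(2)] left H(1) this]
    show ?thesis by (simp add: right[OF p])
  qed
  have alg: "alg_closure ?S (moment_gens g) (\<lambda>p. D p v $ i)" for v i
  proof (rule alg_closure_cramer[OF _ _ _ D_eq])
    show "alg_closure ?S (moment_gens g) (\<lambda>p. gram (gen_poly \<alpha> p) 2 (g p) $ i $ j)" for i j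
    proof -
      have "alg_closure ?S (moment_gens g)
          (\<lambda>p. mom (\<lambda>y. (\<alpha> i y * \<alpha> j y) * gen_poly \<alpha> p y) 2 (g p))"
        by (intro alg_closure_mom_gen_poly g alg_closure_coordinate continuous_intros continuous_alpha)
      then show ?thesis by (simp add: gram_def mult_ac)
    qed
    show "alg_closure ?S (moment_gens g) (\<lambda>p. (gram (\<lambda>x. 1) 1 (g p) *v v) $ i)" for i
      unfolding matrix_vector_mult_def vec_lambda_beta
      by (intro alg_closure_sum alg_closure.mult alg_closure.const alg_closure_gram continuous_on_const)
    show "det (gram (gen_poly \<alpha> p) 2 (g p)) \<noteq> 0" if "p \<in> ?S" for p
      using gram_poly_invertible[OF that g[OF that]] by (simp add: invertible_det_nz)
  qed
  show ?thesis
  proof (rule alg_closure_vec_smooth[OF open_pos_cone])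
    show "alg_differentiable ?S (moment_gens g) b" if "b \<in> moment_gens g" for b
      by (rule moment_gens_differentiable[OF g der alg that])
    show "alg_closure ?S (moment_gens g) (\<lambda>x. g x $ i)" for i
      by (rule alg_closure.gen) (auto simp: moment_gens_def)
  qed
qed

section \<open>The minimizer map as a diffeomorphism\<close>

lemma is_minimizer_iff_eq_stationary:
  assumes "p \<in> pos_cone K \<alpha>" "q \<in> pos_cone K \<alpha>" "stationary c p q"
  shows "is_minimizer K \<alpha> c p y \<longleftrightarrow> y = q"
proof -
  have q: "q \<in> closure (pos_cone K \<alpha>)" using assms(2) closure_subset by blast
  show ?thesis
  proof
    assume "is_minimizer K \<alpha> c p y"
    then show "y = q"
      using stationary_strict_minimum[OF assms, of y] q unfolding is_minimizer_def is_arg_min_def by blast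
  next
    assume "y = q"
    then show "is_minimizer K \<alpha> c p y"
      using stationary_strict_minimum[OF assms] q less_asym
      unfolding is_minimizer_def is_arg_min_def by blast
  qed
qed

lemma gmap_diffeomorphism:
  assumes c: "c \<in> dual_cone K \<alpha>"
    and boundary: "\<And>q. q \<in> closure (pos_cone K \<alpha>) - pos_cone K \<alpha> \<Longrightarrow>
            (\<integral>\<^sup>+ x. 1 / ennreal (gen_poly \<alpha> q x) \<partial>(lebesgue_on K)) = \<infinity>"
  shows "(\<forall>p \<in> pos_cone K \<alpha>. \<exists>!q. is_minimizer K \<alpha> c p q)
    \<and> gmap K \<alpha> c ` pos_cone K \<alpha> \<subseteq> pos_cone K \<alpha>
    \<and> diffeomorphism (pos_cone K \<alpha>) (gmap K \<alpha> c ` pos_cone K \<alpha>) (gmap K \<alpha> c)"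
proof -
  let ?S = "pos_cone K \<alpha>" and ?g = "gmap K \<alpha> c" and ?h = "param_of c"
  have gmap_eqI: "?g p = q" if "p \<in> ?S" "q \<in> ?S" "stationary c p q" for p q
    unfolding gmap_def by (rule the_equality) (simp_all add: is_minimizer_iff_eq_stationary[OF that])
  have g: "?g p \<in> ?S \<and> stationary c p (?g p)" if "p \<in> ?S" for p
    using exists_stationary[OF c that boundary] gmap_eqI[OF that] by metis
  have unique: "\<exists>!q. is_minimizer K \<alpha> c p q" if "p \<in> ?S" for p
    using is_minimizer_iff_eq_stationary[OF that g[OF that, THEN conjunct1] g[OF that, THEN conjunct2]]
    by (intro ex1I[of _ "?g p"]) simp_all
  have right: "?h (?g p) = p" if "p \<in> ?S" for p
    using g[OF that] stationary_iff_param_of by metis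
  have left: "?g (?h q) = q" if "q \<in> ?S" "?h q \<in> ?S" for q
    using gmap_eqI[OF that(2,1)] stationary_iff_param_of[OF that(1)] by blast
  \<comment> \<open>The points of the open cone that are stationary for some admissible parameter;
    as a preimage under the continuous \<open>param_of c\<close> this set is open.\<close>
  define T where "T = ?S \<inter> ?h -` ?S"
  have image: "?g ` ?S = T"
  proof
    show "?g ` ?S \<subseteq> T"
      using g right unfolding T_def by auto
    show "T \<subseteq> ?g ` ?S"
    proof
      fix q assume "q \<in> T"
      then have "q \<in> ?S" "?h q \<in> ?S" unfolding T_def by simp_all
      then show "q \<in> ?g ` ?S" using left by (metis image_eqI)
    qed
  qed
  have "open T"
    unfolding T_def
    by (rule continuous_open_preimage[OF continuous_on_param_of open_pos_cone open_pos_cone])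
  have inj: "inj_on ?g ?S" using right by (metis inj_onI)
  have "smooth_on ?S ?g"
  proof (rule smooth_on_inverse_param_of[where T = T])
    show "?g p \<in> T" if "p \<in> ?S" for p using image that by blast
    show "?g (?h q) = q" if "q \<in> T" for q using left that unfolding T_def by simp
  qed (use g right \<open>open T\<close> in \<open>auto simp: T_def\<close>)
  moreover have "smooth_on T (inv_into ?S ?g)"
  proof (rule smooth_on_param_of[OF \<open>open T\<close>])
    show "inv_into ?S ?g q = ?h q" if "q \<in> T" for q
      using that left inj by (auto simp: T_def intro: inv_into_f_eq)
  qed (auto simp: T_def)
  ultimately have "diffeomorphism ?S (?g ` ?S) ?g"
    unfolding diffeomorphism_def image
    using \<open>open T\<close> open_pos_cone inj image by (simp add: bij_betw_def)
  then show ?thesis using unique g by blast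
qed

end

theorem theorem4p6:
  fixes K :: "(real^'d::finite) set"
    and \<alpha> :: "'n::finite \<Rightarrow> real^'d \<Rightarrow> real"
    and c :: "real^'n"
  assumes "compact K" and "interior K \<noteq> {}" and "closure (interior K) = K"
    and "\<And>k. continuous_on K (\<alpha> k)"
    and "lin_indep_on K \<alpha>"
    and "\<And>p. p \<in> closure (pos_cone K \<alpha>) - {0} \<Longrightarrow>
            {x \<in> K. gen_poly \<alpha> p x = 0} \<in> null_sets lebesgue"
    and "pos_cone K \<alpha> \<noteq> {}"
    and "\<And>q. q \<in> closure (pos_cone K \<alpha>) - pos_cone K \<alpha> \<Longrightarrow>
            (\<integral>\<^sup>+ x. 1 / ennreal (gen_poly \<alpha> q x) \<partial>(lebesgue_on K)) = \<infinity>"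
    and "c \<in> dual_cone K \<alpha>"
  shows "(\<forall>p \<in> pos_cone K \<alpha>. \<exists>!q. is_minimizer K \<alpha> c p q)
    \<and> gmap K \<alpha> c ` pos_cone K \<alpha> \<subseteq> pos_cone K \<alpha>
    \<and> diffeomorphism (pos_cone K \<alpha>) (gmap K \<alpha> c ` pos_cone K \<alpha>) (gmap K \<alpha> c)"
proof -
  interpret moment_problem K \<alpha>
    using assms(1-5) by unfold_locales
  show ?thesis
    using assms(8,9) by (intro gmap_diffeomorphism)
qed

end
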